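(* Let $n$ be a positive integer, let $r>0$, and let $G$ be an $n$-vertex graph with at most $r$ cherries. Then every globally $\left(\frac{n}{1512\, r^{3/4}}\right)$-bounded coloring $c$ of $E(K_n)$ is $G$-rainbow.
   Context: A cherry in a graph is a path on three vertices (counted as a subgraph). An edge-coloring $c$ of $E(K_n)$ is globally $k$-bounded if no color appears on more than $k$ edges of $K_n$. A coloring $c$ of $E(K_n)$ is $G$-rainbow if there is a copy of $G$ in $K_n$ no two of whose edges have the same color under $c$.
   Formalization: Here r is a positive integer: for real r in (0,1) the claim fails (n=4, G two disjoint edges, r tiny, c constant), and for real r ≥ 1 it follows from the integer case applied to the floor of r. *)

theory Defs
  imports Complex_Main
begin

type_synonym 'a graph = "'a set \<times> 'a set set"

abbreviation verts :: "'a graph \<Rightarrow> 'a set" where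
  "verts \<equiv> fst"

abbreviation edges :: "'a graph \<Rightarrow> 'a set set" where
  "edges \<equiv> snd"

definition simple_graph :: "'a graph \<Rightarrow> bool" where
  "simple_graph G \<longleftrightarrow> finite (verts G) \<and> (\<forall>e\<in>edges G. e \<subseteq> verts G \<and> card e = 2)"

definition complete_graph :: "nat \<Rightarrow> nat graph" where
  "complete_graph n = ({..<n}, {e. e \<subseteq> {..<n} \<and> card e = 2})"

definition subgraph :: "'a graph \<Rightarrow> 'a graph \<Rightarrow> bool" where
  "subgraph H G \<longleftrightarrow> simple_graph H \<and> verts H \<subseteq> verts G \<and> edges H \<subseteq> edges G"

definition graph_iso :: "'a graph \<Rightarrow> 'b graph \<Rightarrow> bool" where
  "graph_iso G H \<longleftrightarrow>
     (\<exists>f. bij_betw f (verts G) (verts H) \<and>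
          (\<forall>u\<in>verts G. \<forall>v\<in>verts G. {u, v} \<in> edges G \<longleftrightarrow> {f u, f v} \<in> edges H))"

definition is_cherry :: "'a graph \<Rightarrow> bool" where
  "is_cherry H \<longleftrightarrow>
     (\<exists>x y z. distinct [x, y, z] \<and> H = ({x, y, z}, {{x, y}, {y, z}}))"

definition cherries :: "'a graph \<Rightarrow> 'a graph set" where
  "cherries G = {H. subgraph H G \<and> is_cherry H}"

text \<open>An edge-coloring of \<open>K\<^sub>n\<close> is a function on all sets of naturals of which only the
  values on the edges of \<open>K\<^sub>n\<close> are ever used; the color type is arbitrary.\<close>

definition globally_bounded :: "nat \<Rightarrow> real \<Rightarrow> (nat set \<Rightarrow> 'c) \<Rightarrow> bool" where
  "globally_bounded n k c \<longleftrightarrow>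
     (\<forall>a. real (card {e \<in> edges (complete_graph n). c e = a}) \<le> k)"

definition rainbow :: "nat \<Rightarrow> 'a graph \<Rightarrow> (nat set \<Rightarrow> 'c) \<Rightarrow> bool" where
  "rainbow n G c \<longleftrightarrow>
     (\<exists>H. subgraph H (complete_graph n) \<and> graph_iso G H \<and> inj_on c (edges H))"

end

theory Submission
  imports Defs "HOL-Combinatorics.Transposition" "HOL-Library.FuncSet"
begin

text \<open>
  Put \<open>R = r\<^bsup>1/4\<^esup>\<close>, so that \<open>k R\<^sup>3 \<le> n/1512\<close>, where \<open>k\<close> bounds the color classes. At most \<open>R\<close>
  vertices of \<open>G\<close> are the center of more than \<open>R\<^sup>3\<close> cherries. These high vertices are
  embedded greedily, so that all pairs of their images get different colors and any two images
  \<open>u\<close>, \<open>v\<close> have at most \<open>2Rk\<close> common neighbors \<open>y\<close> with \<open>c(uy) = c(vy)\<close>. The remaining vertices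
  are placed by a random bijection. Following Lu and Szekely, the events ``the bijection extends
  a given partial matching'' satisfy the lopsided local lemma when events are adjacent whenever
  the union of their matchings is not a matching. A bad event places at most four vertices so
  that two edges of \<open>G\<close> get the same color; at each vertex of \<open>G\<close> and at each vertex of \<open>K\<^sub>n\<close> the
  number of bad events that place \<open>j\<close> vertices is at most a constant times
  \<open>k R\<^sup>3 n\<^bsup>j-1\<^esup>\<close>, and the constants add up to \<open>84\<close>.

  Two points matter for these counts. If only one vertex is left free, the
  events are the pairs (free vertex, forbidden image), irrespective of how many pairs of
  edges forbid the image. And when an image is fixed, the high vertices are to be counted through
  the color classes rather than one by one.\<close>

subsection \<open>The lopsided local lemma for random bijections\<close>

text \<open>Extensional functions, so that there are finitely many of them and \<open>card\<close>
  counts each bijection from \<open>A\<close> to \<open>B\<close> once.\<close>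

definition bijections :: "'a set \<Rightarrow> 'b set \<Rightarrow> ('a \<Rightarrow> 'b) set" where
  "bijections A B = {\<pi> \<in> A \<rightarrow>\<^sub>E B. bij_betw \<pi> A B}"

definition extends :: "('a \<Rightarrow> 'b) \<Rightarrow> ('a \<times> 'b) set \<Rightarrow> bool" where
  "extends \<pi> M \<longleftrightarrow> (\<forall>(x, y)\<in>M. \<pi> x = y)"

text \<open>For two matchings this says that their union is not a matching: a pair common to both
  gives no conflict by itself.\<close>

definition conflict :: "('a \<times> 'b) set \<Rightarrow> ('a \<times> 'b) set \<Rightarrow> bool" where
  "conflict M M' \<longleftrightarrow> (\<exists>(x, y)\<in>M. \<exists>(x', y')\<in>M'. (x = x') \<noteq> (y = y'))"

definition avoiding :: "'a set \<Rightarrow> 'b set \<Rightarrow> ('a \<times> 'b) set set \<Rightarrow> ('a \<Rightarrow> 'b) set" where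
  "avoiding A B S = {\<pi> \<in> bijections A B. \<forall>M\<in>S. \<not> extends \<pi> M}"

lemma finite_avoiding: "finite A \<Longrightarrow> finite B \<Longrightarrow> finite (avoiding A B S)"
  unfolding avoiding_def bijections_def by (simp add: finite_PiE)

text \<open>Exchanging the value at \<open>x\<close> with that at any point outside the domain of the remaining
  pairs can destroy, but never create, an extension of a matching that is compatible with \<open>M\<close>.\<close>

lemma card_extends_remove_pair:
  assumes fin: "finite A" "finite B" and M: "M \<subseteq> A \<times> B" "finite M" and xy: "(x, y) \<in> M"
    and nc: "\<And>M'. M' \<in> S \<Longrightarrow> \<not> conflict M' M"
  shows "(card A - (card M - 1)) * card {\<pi> \<in> avoiding A B S. extends \<pi> M}
         \<le> card {\<pi> \<in> avoiding A B S. extends \<pi> (M - {(x, y)})}"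
proof -
  define X where "X = A - fst ` (M - {(x, y)})"
  define P where "P = {\<pi> \<in> avoiding A B S. extends \<pi> M}"
  define h where "h = (\<lambda>(\<pi> :: 'a \<Rightarrow> 'b, z). \<pi> \<circ> transpose x z)"
  have xA: "x \<in> A" using M xy by auto
  have piD: "inj_on \<pi> A" "\<pi> x = y" "bij_betw \<pi> A B" "\<pi> \<in> A \<rightarrow>\<^sub>E B" if "\<pi> \<in> P" for \<pi>
    using that xy unfolding P_def avoiding_def bijections_def extends_def bij_betw_def by auto
  \<comment> \<open>The new bijection determines \<open>z\<close> as its only preimage of
    \<open>y\<close>, and a second exchange recovers \<open>\<pi>\<close>.\<close>
  have inj: "inj_on h (P \<times> X)"
  proof (rule inj_onI, clarify)
    fix \<pi> z \<rho> w assume a: "\<pi> \<in> P" "z \<in> X" "\<rho> \<in> P" "w \<in> X" "h (\<pi>, z) = h (\<rho>, w)"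
    have eq: "\<pi> (transpose x z v) = \<rho> (transpose x w v)" for v
      using a(5) unfolding h_def by (metis comp_apply prod.case)
    have "\<rho> x = y" "\<pi> x = y" using a piD by auto
    then have "\<rho> (transpose x w z) = \<rho> x" using eq[of z] by simp
    moreover have "transpose x w z \<in> A" using a xA unfolding X_def by (auto simp: transpose_def)
    ultimately have "transpose x w z = x" using piD(1)[OF a(3)] xA by (auto dest: inj_onD)
    then have zw: "z = w" by (metis transpose_eq_iff transpose_apply_first)
    have "\<pi> v = \<rho> v" for v using eq[of "transpose x z v"] zw by simp
    then show "\<pi> = \<rho> \<and> z = w" using zw by auto
  qed
  have sub: "h ` (P \<times> X) \<subseteq> {\<pi> \<in> avoiding A B S. extends \<pi> (M - {(x, y)})}"
  proof clarify
    fix \<pi> z assume a: "\<pi> \<in> P" "z \<in> X"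
    define \<pi>' where "\<pi>' = \<pi> \<circ> transpose x z"
    have zA: "z \<in> A" using a(2) unfolding X_def by auto
    have bt: "bij_betw (transpose x z) A A"
      by (rule bij_betw_byWitness[where f' = "transpose x z"]) (use xA zA in \<open>auto simp: transpose_def\<close>)
    have b: "bij_betw \<pi>' A B" unfolding \<pi>'_def by (rule bij_betw_trans[OF bt piD(3)[OF a(1)]])
    have "\<pi>' v = undefined" if "v \<notin> A" for v
      using that xA zA piD(4)[OF a(1)] unfolding \<pi>'_def by (auto simp: transpose_def)
    then have bij: "\<pi>' \<in> bijections A B" unfolding bijections_def
      using b bij_betwE by (fastforce simp: PiE_def extensional_def)
    have "\<pi>' v = w" if vw: "(v, w) \<in> M" "(v, w) \<noteq> (x, y)" for v w
    proof -
      have "\<pi> v = w" using a(1) vw(1) unfolding P_def extends_def by auto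
      moreover have "v \<noteq> x" using calculation piD(2)[OF a(1)] vw(2) by auto
      moreover have "v \<noteq> z" using a(2) vw unfolding X_def by force
      ultimately show ?thesis unfolding \<pi>'_def by (simp add: transpose_def)
    qed
    then have ext: "extends \<pi>' (M - {(x, y)})" unfolding extends_def by blast
    have "\<not> extends \<pi>' M'" if M': "M' \<in> S" for M'
    proof
      assume e: "extends \<pi>' M'"
      have ne: "\<not> extends \<pi> M'" using a(1) M' unfolding P_def avoiding_def by auto
      have zx: "z \<noteq> x" using e ne unfolding \<pi>'_def by auto
      have "\<pi> v = w" if vw: "(v, w) \<in> M'" for v w
      proof -
        have w: "\<pi>' v = w" using e vw unfolding extends_def by auto
        \<comment> \<open>A pair of \<open>M'\<close> contains \<open>x\<close> iff it contains
          \<open>y\<close>. As \<open>\<pi>'\<close> takes the value \<open>y\<close> at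
          \<open>z \<noteq> x\<close>, \<open>M'\<close> involves neither \<open>x\<close> nor
          \<open>z\<close>, the only points where \<open>\<pi>\<close> and \<open>\<pi>'\<close>
          differ.\<close>
        have c: "v = x \<longleftrightarrow> w = y" using nc[OF M'] vw xy unfolding conflict_def by blast
        have "v \<noteq> x"
        proof
          assume "v = x"
          then have "\<pi> z = \<pi> x" using w c piD(2)[OF a(1)] unfolding \<pi>'_def by simp
          then show False using piD(1)[OF a(1)] zx zA xA by (auto dest: inj_onD)
        qed
        moreover have "v \<noteq> z"
          using w c calculation piD(2)[OF a(1)] unfolding \<pi>'_def by auto
        ultimately show ?thesis using w unfolding \<pi>'_def by (simp add: transpose_def)
      qed
      then show False using ne unfolding extends_def by auto
    qed
    then have "\<pi>' \<in> avoiding A B S" using bij unfolding avoiding_def by auto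
    then show "h (\<pi>, z) \<in> avoiding A B S \<and> extends (h (\<pi>, z)) (M - {(x, y)})"
      using ext unfolding h_def \<pi>'_def by auto
  qed
  have "card (P \<times> X) \<le> card {\<pi> \<in> avoiding A B S. extends \<pi> (M - {(x, y)})}"
    by (rule card_inj_on_le[OF inj sub]) (simp add: finite_avoiding fin)
  moreover have "card (fst ` (M - {(x, y)})) \<le> card M - 1"
    by (metis M(2) card_Diff_singleton card_image_le finite_Diff xy)
  then have "card A - (card M - 1) \<le> card X"
    unfolding X_def using diff_card_le_card_Diff[of "fst ` (M - {(x, y)})" A] M(2) by force
  then have "(card A - (card M - 1)) * card P \<le> card (P \<times> X)"
    by (simp add: card_cartesian_product)
  ultimately show ?thesis unfolding P_def by linarith
qed

text \<open>Dropping the pairs of \<open>M\<close> one at a time, each removal costs a factor of at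
  most \<open>1 / (card A - l + 1)\<close>. This bounds the probability of extending
  \<open>M\<close> conditionally on avoiding all of \<open>S\<close>, which is the form of
  independence that the local lemma needs.\<close>

lemma card_extends_le:
  assumes fin: "finite A" "finite B" and M: "finite M" "M \<subseteq> A \<times> B" "card M \<le> l" and l: "l \<le> card A"
    and nc: "\<And>M'. M' \<in> S \<Longrightarrow> \<not> conflict M' M"
  shows "real (card {\<pi> \<in> avoiding A B S. extends \<pi> M})
         \<le> (1 / (real (card A) - real l + 1)) ^ card M * real (card (avoiding A B S))"
  using M nc
proof (induction M rule: finite_induct)
  case empty
  then show ?case by (simp add: extends_def)
next
  case (insert p M)
  obtain x y where p: "p = (x, y)" by fastforce
  define q where "q = 1 / (real (card A) - real l + 1)"
  have q: "q > 0" using l unfolding q_def by simp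
  let ?a = "real (card {\<pi> \<in> avoiding A B S. extends \<pi> (insert p M)})"
  let ?b = "real (card {\<pi> \<in> avoiding A B S. extends \<pi> M})"
  have c: "card (insert p M) = Suc (card M)" using insert by simp
  have "(card A - card M) * card {\<pi> \<in> avoiding A B S. extends \<pi> (insert p M)}
      \<le> card {\<pi> \<in> avoiding A B S. extends \<pi> M}"
    using card_extends_remove_pair[of A B "insert p M" x y S] insert fin c p by simp
  then have "real ((card A - card M) * card {\<pi> \<in> avoiding A B S. extends \<pi> (insert p M)}) \<le> ?b"
    by (rule of_nat_mono)
  then have "real (card A - card M) * ?a \<le> ?b" by (simp only: of_nat_mult)
  moreover have "1 / q \<le> real (card A - card M)" using c insert.prems(2) l unfolding q_def by simp
  ultimately have "1 / q * ?a \<le> ?b"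
    using mult_right_mono[of "1 / q" "real (card A - card M)" ?a] by linarith
  then have "?a \<le> q * ?b" using q by (simp add: field_simps)
  moreover have "?b \<le> q ^ card M * real (card (avoiding A B S))"
    unfolding q_def
  proof (rule insert.IH)
    show "\<not> conflict M' M" if "M' \<in> S" for M'
      using insert.prems(3)[OF that] unfolding conflict_def by blast
  qed (use insert.prems c in auto)
  then have "q * ?b \<le> q * (q ^ card M * real (card (avoiding A B S)))"
    using q by (intro mult_left_mono) auto
  ultimately show ?case unfolding c q_def[symmetric] by (simp add: mult.assoc)
qed

text \<open>The usual induction, with counts in place of conditional probabilities: given that the
  events of \<open>S\<close> are avoided, \<open>M\<close> occurs with probability at most
  \<open>2 * q ^ card M\<close>. The quarters in the hypotheses make the conflicting events
  together, and also each single event, cost at most one half.\<close>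

lemma lopsided_local_lemma:
  fixes A :: "'a set" and B :: "'b set"
  assumes fin: "finite A" "finite B" "finite \<M>" and AB: "card A = card B"
    and M: "\<And>M. M \<in> \<M> \<Longrightarrow> M \<subseteq> A \<times> B \<and> card M \<le> l" and l: "l \<le> card A"
    and q: "q = 1 / (real (card A) - real l + 1)"
    and small: "\<And>M. M \<in> \<M> \<Longrightarrow> q ^ card M \<le> 1 / 4"
    and sum: "\<And>M. M \<in> \<M> \<Longrightarrow> (\<Sum>M' | M' \<in> \<M> \<and> conflict M' M. q ^ card M') \<le> 1 / 4"
  shows "\<exists>\<pi>. bij_betw \<pi> A B \<and> (\<forall>M\<in>\<M>. \<not> extends \<pi> M)"
proof -
  have q0: "q > 0" using l unfolding q by simp
  have finM: "finite M" if "M \<in> \<M>" for M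
    using M[OF that] fin finite_subset by blast
  have key: "real (card {\<pi> \<in> avoiding A B S. extends \<pi> M}) \<le> 2 * q ^ card M * real (card (avoiding A B S))"
    if "S \<subseteq> \<M>" "M \<in> \<M>" for S M
    using that
  proof (induction "card S" arbitrary: S M rule: less_induct)
    case less
    define S1 where "S1 = {M' \<in> S. conflict M' M}"
    define S2 where "S2 = S - S1"
    have finS: "finite S" using less.prems fin finite_subset by blast
    have nb: "real (card {\<pi> \<in> avoiding A B S2. extends \<pi> M}) \<le> q ^ card M * real (card (avoiding A B S2))"
      unfolding q by (rule card_extends_le)
        (use fin M[OF less.prems(2)] finM[OF less.prems(2)] l in \<open>auto simp: S2_def S1_def\<close>)
    \<comment> \<open>Requiring that the conflicting events \<open>S1\<close> be avoided as well
      keeps at least half of the bijections: by induction and a union bound, these events take away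
      at most the fraction \<open>2 * (1 / 4)\<close>.\<close>
    have half: "real (card (avoiding A B S2)) \<le> 2 * real (card (avoiding A B S))"
    proof (cases "S1 = {}")
      case True
      then show ?thesis by (simp add: S2_def)
    next
      case False
      have "card S2 < card S" unfolding S2_def using False finS
        by (intro psubset_card_mono) (auto simp: S1_def)
      then have IH: "real (card {\<pi> \<in> avoiding A B S2. extends \<pi> M'}) \<le> 2 * q ^ card M' * real (card (avoiding A B S2))"
        if "M' \<in> S1" for M'
        using less.hyps[of S2 M'] that less.prems by (auto simp: S2_def S1_def)
      have "avoiding A B S2 \<subseteq> avoiding A B S \<union> (\<Union>M'\<in>S1. {\<pi> \<in> avoiding A B S2. extends \<pi> M'})"
        unfolding avoiding_def S2_def by auto
      then have "card (avoiding A B S2) \<le> card (avoiding A B S \<union> (\<Union>M'\<in>S1. {\<pi> \<in> avoiding A B S2. extends \<pi> M'}))"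
        by (intro card_mono) (use finS fin in \<open>auto simp: finite_avoiding S1_def\<close>)
      also have "\<dots> \<le> card (avoiding A B S) + card (\<Union>M'\<in>S1. {\<pi> \<in> avoiding A B S2. extends \<pi> M'})"
        by (rule card_Un_le)
      also have "\<dots> \<le> card (avoiding A B S) + (\<Sum>M'\<in>S1. card {\<pi> \<in> avoiding A B S2. extends \<pi> M'})"
        using finS by (intro add_left_mono card_UN_le) (auto simp: S1_def)
      finally have "real (card (avoiding A B S2)) \<le> real (card (avoiding A B S))
          + (\<Sum>M'\<in>S1. real (card {\<pi> \<in> avoiding A B S2. extends \<pi> M'}))"
        unfolding of_nat_sum[symmetric] of_nat_add[symmetric] by (rule of_nat_mono)
      moreover have "(\<Sum>M'\<in>S1. real (card {\<pi> \<in> avoiding A B S2. extends \<pi> M'}))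
          \<le> (\<Sum>M'\<in>S1. 2 * q ^ card M' * real (card (avoiding A B S2)))"
        by (rule sum_mono) (rule IH)
      moreover have "(\<Sum>M'\<in>S1. 2 * q ^ card M' * real (card (avoiding A B S2)))
          = 2 * (\<Sum>M'\<in>S1. q ^ card M') * real (card (avoiding A B S2))"
        by (simp add: sum_distrib_left sum_distrib_right mult.assoc)
      moreover have "2 * (\<Sum>M'\<in>S1. q ^ card M') * real (card (avoiding A B S2))
          \<le> 2 * (1 / 4) * real (card (avoiding A B S2))"
      proof -
        have "(\<Sum>M'\<in>S1. q ^ card M') \<le> (\<Sum>M' | M' \<in> \<M> \<and> conflict M' M. q ^ card M')"
          by (rule sum_mono2) (use fin less.prems q0 in \<open>auto simp: S1_def\<close>)
        then show ?thesis using sum[OF less.prems(2)] by (intro mult_right_mono) auto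
      qed
      ultimately show ?thesis by simp
    qed
    have "card {\<pi> \<in> avoiding A B S. extends \<pi> M} \<le> card {\<pi> \<in> avoiding A B S2. extends \<pi> M}"
    proof (rule card_mono)
      show "finite {\<pi> \<in> avoiding A B S2. extends \<pi> M}" by (simp add: finite_avoiding fin)
    qed (auto simp: avoiding_def S2_def)
    then have "real (card {\<pi> \<in> avoiding A B S. extends \<pi> M}) \<le> q ^ card M * real (card (avoiding A B S2))"
      using nb by linarith
    also have "\<dots> \<le> q ^ card M * (2 * real (card (avoiding A B S)))"
      using half q0 by (intro mult_left_mono) auto
    finally show ?case by simp
  qed
  \<comment> \<open>The events are imposed one after the other; each takes away at most half of the
    bijections still left.\<close>
  have "avoiding A B S \<noteq> {}" if "finite S" "S \<subseteq> \<M>" for S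
    using that
  proof (induction S rule: finite_induct)
    case empty
    obtain \<pi> where b: "bij_betw \<pi> A B" using finite_same_card_bij[OF fin(1,2) AB] by blast
    have "bij_betw (restrict \<pi> A) A B" using b by (simp add: bij_betw_def inj_on_def)
    then have "restrict \<pi> A \<in> avoiding A B {}"
      using b unfolding avoiding_def bijections_def by (auto simp: bij_betw_def)
    then show ?case by blast
  next
    case (insert M S)
    have pos: "real (card (avoiding A B S)) > 0"
      using insert finite_avoiding[OF fin(1,2), of S] by (auto simp: card_gt_0_iff)
    have "real (card {\<pi> \<in> avoiding A B S. extends \<pi> M}) \<le> 2 * q ^ card M * real (card (avoiding A B S))"
      using key insert by auto
    also have "\<dots> \<le> 2 * (1 / 4) * real (card (avoiding A B S))"
      using small[of M] insert by (intro mult_right_mono) auto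
    also have "\<dots> < real (card (avoiding A B S))" using pos by simp
    finally have "{\<pi> \<in> avoiding A B S. extends \<pi> M} \<noteq> avoiding A B S" by auto
    then show ?case unfolding avoiding_def by auto
  qed
  then obtain \<pi> where "\<pi> \<in> avoiding A B \<M>" using fin by blast
  then show ?thesis unfolding avoiding_def bijections_def by auto
qed

text \<open>Finiteness is part of the bound because \<open>card\<close> is 0 on infinite sets. The
  bound is real since products such as \<open>2 * R * k\<close> need not be integers.\<close>

definition at_most :: "'a set \<Rightarrow> real \<Rightarrow> bool" where
  "at_most S b \<longleftrightarrow> finite S \<and> real (card S) \<le> b"

lemma at_most_mono: "at_most T a \<Longrightarrow> S \<subseteq> T \<Longrightarrow> a \<le> b \<Longrightarrow> at_most S b"
  unfolding at_most_def by (meson card_mono finite_subset of_nat_le_iff order_trans)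

lemma at_most_image: "at_most S a \<Longrightarrow> at_most (f ` S) a"
  unfolding at_most_def by (meson card_image_le finite_imageI of_nat_le_iff order_trans)

lemma at_most_inj_image: "at_most (f ` S) a \<Longrightarrow> inj_on f S \<Longrightarrow> at_most S a"
  unfolding at_most_def by (simp add: card_image finite_image_iff)

lemma at_most_doubleton: "at_most {x, y} 2"
  unfolding at_most_def by (simp add: card_insert_if)

lemma at_most_Un: "at_most S a \<Longrightarrow> at_most T b \<Longrightarrow> at_most (S \<union> T) (a + b)"
  unfolding at_most_def using card_Un_le[of S T] by (auto intro: order_trans[of _ "real (card S + card T)"])

lemma at_most_Sigma:
  assumes "at_most X a" "\<And>x. x \<in> X \<Longrightarrow> at_most (Y x) b" "0 \<le> b"
  shows "at_most (Sigma X Y) (a * b)"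
proof -
  have fin: "finite X" "\<forall>x\<in>X. finite (Y x)" using assms unfolding at_most_def by auto
  have "real (card (Sigma X Y)) = (\<Sum>x\<in>X. real (card (Y x)))" using fin by simp
  also have "\<dots> \<le> real (card X) * b"
    using assms(2) unfolding at_most_def by (intro sum_bounded_above) auto
  also have "\<dots> \<le> a * b" using assms(1,3) unfolding at_most_def by (intro mult_right_mono) auto
  finally show ?thesis unfolding at_most_def using fin by auto
qed

lemma at_most_Sigma_pair:
  assumes "at_most X a" "\<And>x y. (x, y) \<in> X \<Longrightarrow> at_most (Y x y) b" "0 \<le> b"
  shows "at_most (SIGMA (x, y):X. Y x y) (a * b)"
  by (rule at_most_Sigma) (use assms in auto)

lemma at_most_UN:
  assumes "at_most X a" "\<And>x. x \<in> X \<Longrightarrow> at_most (Y x) b" "0 \<le> b"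
  shows "at_most (\<Union>x\<in>X. Y x) (a * b)"
proof -
  have "(\<Union>x\<in>X. Y x) = snd ` Sigma X Y" by force
  then show ?thesis by (simp only: at_most_image[OF at_most_Sigma[OF assms]])
qed

lemma sum_UN_le:
  fixes f :: "'a \<Rightarrow> real"
  assumes "finite I" "\<And>i. i \<in> I \<Longrightarrow> finite (S i)" "\<And>x. 0 \<le> f x"
  shows "sum f (\<Union>i\<in>I. S i) \<le> (\<Sum>i\<in>I. sum f (S i))"
  using assms
proof (induction I rule: finite_induct)
  case (insert i I)
  have "sum f (\<Union>i\<in>insert i I. S i) \<le> sum f (S i) + sum f (\<Union>i\<in>I. S i)"
    using insert by (simp add: sum_Un sum_nonneg)
  then show ?case using insert by fastforce
qed simp

text \<open>A conflict requires a common vertex in \<open>A\<close> or in \<open>B\<close>, and a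
  matching with at most \<open>l\<close> pairs has at most \<open>l\<close> vertices on either side.
  So it suffices to count events by size at single vertices: each pair of \<open>M\<close> accounts
  for conflicts of weight at most \<open>1 / (4 * l)\<close>.\<close>

lemma vertexwise_local_lemma:
  fixes A :: "'a set" and B :: "'b set" and \<M> :: "nat \<Rightarrow> ('a \<times> 'b) set set"
  assumes fin: "finite A" "finite B" and AB: "card A = card B" and l: "1 \<le> l" "l \<le> card A"
    and M: "\<And>j M. j \<in> {1..l} \<Longrightarrow> M \<in> \<M> j \<Longrightarrow> M \<subseteq> A \<times> B \<and> card M = j"
    and dom: "\<And>j x. j \<in> {1..l} \<Longrightarrow> x \<in> A \<Longrightarrow> at_most {M \<in> \<M> j. x \<in> fst ` M} (a j)"
    and ran: "\<And>j y. j \<in> {1..l} \<Longrightarrow> y \<in> B \<Longrightarrow> at_most {M \<in> \<M> j. y \<in> snd ` M} (b j)"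
    and q: "q = 1 / (real (card A) - real l + 1)"
    and sum: "(\<Sum>j = 1..l. (a j + b j) * q ^ j) \<le> 1 / (4 * real l)"
  shows "\<exists>\<pi>. bij_betw \<pi> A B \<and> (\<forall>j\<in>{1..l}. \<forall>M\<in>\<M> j. \<not> extends \<pi> M)"
proof -
  have q0: "q > 0" using l unfolding q by simp
  define \<N> where "\<N> = (\<Union>j\<in>{1..l}. \<M> j)"
  have finj: "finite (\<M> j)" if "j \<in> {1..l}" for j
    by (rule finite_subset[of _ "Pow (A \<times> B)"]) (use M[OF that] fin in auto)
  have finN: "finite \<N>" unfolding \<N>_def using finj by blast
  have part: "(\<Sum>M | M \<in> \<N> \<and> P M. q ^ card M) \<le> (\<Sum>j = 1..l. c j * q ^ j)"
    if "\<And>j. j \<in> {1..l} \<Longrightarrow> at_most {M \<in> \<M> j. P M} (c j)" for P c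
  proof -
    have "{M. M \<in> \<N> \<and> P M} = (\<Union>j\<in>{1..l}. {M \<in> \<M> j. P M})" unfolding \<N>_def by auto
    then have "(\<Sum>M | M \<in> \<N> \<and> P M. q ^ card M) \<le> (\<Sum>j\<in>{1..l}. \<Sum>M | M \<in> \<M> j \<and> P M. q ^ card M)"
      using finj q0 sum_UN_le[of "{1..l}" "\<lambda>j. {M \<in> \<M> j. P M}" "\<lambda>M. q ^ card M"] by auto
    also have "\<dots> = (\<Sum>j\<in>{1..l}. real (card {M \<in> \<M> j. P M}) * q ^ j)"
      by (intro sum.cong refl) (use M in simp)
    also have "\<dots> \<le> (\<Sum>j = 1..l. c j * q ^ j)"
      using that q0 unfolding at_most_def by (intro sum_mono mult_right_mono) auto
    finally show ?thesis .
  qed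
  define \<alpha> where "\<alpha> = (\<Sum>j = 1..l. a j * q ^ j)"
  define \<beta> where "\<beta> = (\<Sum>j = 1..l. b j * q ^ j)"
  have \<alpha>\<beta>: "\<alpha> + \<beta> \<le> 1 / (4 * real l)"
    using sum unfolding \<alpha>_def \<beta>_def by (simp add: sum.distrib distrib_right)
  have domS: "(\<Sum>M | M \<in> \<N> \<and> x \<in> fst ` M. q ^ card M) \<le> \<alpha>" if "x \<in> A" for x
    unfolding \<alpha>_def by (rule part) (use dom that in auto)
  have ranS: "(\<Sum>M | M \<in> \<N> \<and> y \<in> snd ` M. q ^ card M) \<le> \<beta>" if "y \<in> B" for y
    unfolding \<beta>_def by (rule part) (use ran that in auto)
  have MN: "M \<subseteq> A \<times> B \<and> card M \<le> l \<and> M \<noteq> {} \<and> finite M" if "M \<in> \<N>" for M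
    using that M fin unfolding \<N>_def by (fastforce intro: card_ge_0_finite)
  have "\<exists>\<pi>. bij_betw \<pi> A B \<and> (\<forall>M\<in>\<N>. \<not> extends \<pi> M)"
  proof (rule lopsided_local_lemma[OF fin finN AB _ l(2) q])
    fix M assume MM: "M \<in> \<N>"
    show "M \<subseteq> A \<times> B \<and> card M \<le> l" using MN[OF MM] by blast
    have "(\<Sum>M' | M' \<in> \<N> \<and> conflict M' M. q ^ card M')
        \<le> (\<Sum>M'\<in>(\<Union>p\<in>M. {M' \<in> \<N>. fst p \<in> fst ` M'} \<union> {M' \<in> \<N>. snd p \<in> snd ` M'}). q ^ card M')"
    proof (rule sum_mono2)
      show "{M'. M' \<in> \<N> \<and> conflict M' M}
          \<subseteq> (\<Union>p\<in>M. {M' \<in> \<N>. fst p \<in> fst ` M'} \<union> {M' \<in> \<N>. snd p \<in> snd ` M'})"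
      proof clarify
        fix M' assume M': "M' \<in> \<N>" "conflict M' M"
        then obtain x y x' y' where "(x, y) \<in> M'" "(x', y') \<in> M" "x = x' \<or> y = y'"
          unfolding conflict_def by blast
        then show "M' \<in> (\<Union>p\<in>M. {M' \<in> \<N>. fst p \<in> fst ` M'} \<union> {M' \<in> \<N>. snd p \<in> snd ` M'})"
          using M'(1) by (intro UN_I[of "(x', y')"]) force+
      qed
    qed (use MN[OF MM] finN q0 in auto)
    also have "\<dots> \<le> (\<Sum>p\<in>M. \<Sum>M'\<in>{M' \<in> \<N>. fst p \<in> fst ` M'} \<union> {M' \<in> \<N>. snd p \<in> snd ` M'}. q ^ card M')"
      by (rule sum_UN_le) (use MN[OF MM] finN q0 in auto)
    also have "\<dots> \<le> (\<Sum>p\<in>M. \<alpha> + \<beta>)"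
    proof (rule sum_mono)
      fix p assume "p \<in> M"
      then have p: "fst p \<in> A" "snd p \<in> B" using MN[OF MM] by auto
      have "(\<Sum>M'\<in>{M' \<in> \<N>. fst p \<in> fst ` M'} \<union> {M' \<in> \<N>. snd p \<in> snd ` M'}. q ^ card M')
          \<le> (\<Sum>M' | M' \<in> \<N> \<and> fst p \<in> fst ` M'. q ^ card M') + (\<Sum>M' | M' \<in> \<N> \<and> snd p \<in> snd ` M'. q ^ card M')"
        using finN q0 by (simp add: sum_Un sum_nonneg)
      then show "(\<Sum>M'\<in>{M' \<in> \<N>. fst p \<in> fst ` M'} \<union> {M' \<in> \<N>. snd p \<in> snd ` M'}. q ^ card M') \<le> \<alpha> + \<beta>"
        using domS[OF p(1)] ranS[OF p(2)] by linarith
    qed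
    also have "\<dots> = real (card M) * (\<alpha> + \<beta>)" by simp
    also have "\<dots> \<le> real (card M) * (1 / (4 * real l))" using \<alpha>\<beta> by (intro mult_left_mono) auto
    also have "\<dots> \<le> real l * (1 / (4 * real l))" using MN[OF MM] by (intro mult_right_mono) auto
    also have "\<dots> = 1 / 4" using l by simp
    finally show "(\<Sum>M' | M' \<in> \<N> \<and> conflict M' M. q ^ card M') \<le> 1 / 4" .
    \<comment> \<open>A single event is light because it is itself among the events counted at any
      of its vertices.\<close>
    obtain x y where xy: "(x, y) \<in> M" using MN[OF MM] by auto
    have "q ^ card M = (\<Sum>M'\<in>{M}. q ^ card M')" by simp
    also have "\<dots> \<le> (\<Sum>M' | M' \<in> \<N> \<and> x \<in> fst ` M'. q ^ card M')"
      by (rule sum_mono2) (use finN MM xy q0 in force)+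
    also have "\<dots> \<le> \<alpha>" using domS[of x] xy MN[OF MM] by auto
    finally have "q ^ card M \<le> \<alpha>" .
    \<comment> \<open>\<open>\<beta>\<close> is nonnegative because it bounds a sum of weights, so
      \<open>\<alpha>\<close> alone is at most \<open>1 / (4 * real l)\<close>.\<close>
    moreover have "0 \<le> (\<Sum>M' | M' \<in> \<N> \<and> y \<in> snd ` M'. q ^ card M')" using q0 by (simp add: sum_nonneg)
    then have "0 \<le> \<beta>" using ranS[of y] xy MN[OF MM] by auto
    moreover have "1 / (4 * real l) \<le> 1 / 4" using l by (simp add: field_simps)
    ultimately show "q ^ card M \<le> 1 / 4" using \<alpha>\<beta> by linarith
  qed
  then show ?thesis unfolding \<N>_def by blast
qed

subsection \<open>Degrees and color classes\<close>

text \<open>\<open>R\<close> is the fourth root of the bound on cherries, and \<open>few\<close>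
  counts each cherry in both directions. The bound on \<open>R ^ 3\<close> comes from the one on
  \<open>k * R ^ 3\<close> together with \<open>1 \<le> k\<close>.\<close>

locale few_cherries =
  fixes V :: "'a set" and adj :: "'a \<Rightarrow> 'a \<Rightarrow> bool" and n :: nat and R :: real
  assumes finV: "finite V" and cardV: "card V = n"
    and adj_sym: "adj u v \<Longrightarrow> adj v u" and adj_irrefl: "\<not> adj v v" and adj_V: "adj u v \<Longrightarrow> u \<in> V"
    and R: "1 \<le> R" and n_R: "1512 * R ^ 3 \<le> real n"
    and few: "at_most {(y, z, w). adj y z \<and> adj z w \<and> y \<noteq> w} (2 * R ^ 4)"
begin

lemma adj_V2: "adj u v \<Longrightarrow> v \<in> V"
  using adj_sym adj_V by blast

lemma finite_nbrs: "finite {w. adj v w}"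
  by (rule finite_subset[OF _ finV]) (auto dest: adj_V2)

definition deg :: "'a \<Rightarrow> real" where
  "deg v = real (card {w. adj v w})"

lemma at_most_nbrs: "at_most {w. adj v w} (deg v)"
  unfolding at_most_def deg_def by (simp add: finite_nbrs)

lemma deg_nonneg: "0 \<le> deg v"
  unfolding deg_def by simp

lemma deg_cases: "deg v = 0 \<or> 1 \<le> deg v"
  unfolding deg_def by (cases "card {w. adj v w}") auto

lemma deg_cherries_nonneg: "0 \<le> deg v * (deg v - 1)"
  using deg_cases[of v] by auto

lemma card_nbr_pairs: "real (card {(a, b). adj v a \<and> adj v b \<and> a \<noteq> b}) = deg v * (deg v - 1)"
proof -
  have eq: "{(a, b). adj v a \<and> adj v b \<and> a \<noteq> b} = (SIGMA a:{w. adj v w}. {w. adj v w} - {a})" by auto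
  have "card {(a, b). adj v a \<and> adj v b \<and> a \<noteq> b} = (\<Sum>a\<in>{w. adj v w}. card {w. adj v w} - 1)"
    unfolding eq by (simp add: finite_nbrs)
  then show ?thesis
    unfolding deg_def by (cases "card {w. adj v w}") (auto simp: algebra_simps)
qed

lemma finite_nbr_pairs: "finite {(a, b). adj v a \<and> adj v b \<and> a \<noteq> b}"
  by (rule finite_subset[of _ "{w. adj v w} \<times> {w. adj v w}"]) (auto simp: finite_nbrs)

lemma at_most_nbr_pairs: "at_most {(a, b). adj v a \<and> adj v b \<and> a \<noteq> b} (deg v * (deg v - 1))"
  unfolding at_most_def using card_nbr_pairs finite_nbr_pairs by simp

text \<open>\<open>deg v * (deg v - 1)\<close> counts the ordered cherries with center
  \<open>v\<close>, and a cherry has only one center.\<close>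

lemma sum_deg_cherries:
  assumes "W \<subseteq> V"
  shows "(\<Sum>v\<in>W. deg v * (deg v - 1)) \<le> 2 * R ^ 4"
proof -
  let ?P = "\<lambda>v. {(a, b). adj v a \<and> adj v b \<and> a \<noteq> b}"
  have finW: "finite W" using assms finV finite_subset by blast
  have "(\<Sum>v\<in>W. deg v * (deg v - 1)) = real (\<Sum>v\<in>W. card (?P v))"
    by (simp add: card_nbr_pairs)
  also have "(\<Sum>v\<in>W. card (?P v)) = card (Sigma W ?P)"
    by (rule card_SigmaI[symmetric]) (auto simp: finW finite_nbr_pairs)
  finally have eq: "(\<Sum>v\<in>W. deg v * (deg v - 1)) = real (card (Sigma W ?P))" .
  have "at_most ((\<lambda>(z, y, w). (y, z, w)) ` Sigma W ?P) (2 * R ^ 4)"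
    by (rule at_most_mono[OF few]) (auto intro: adj_sym)
  then have "at_most (Sigma W ?P) (2 * R ^ 4)"
    by (rule at_most_inj_image) (auto simp: inj_on_def)
  then show ?thesis using eq unfolding at_most_def by simp
qed

lemma deg_le: "deg v \<le> 2 * R ^ 2"
proof (cases "deg v = 0")
  case True
  then show ?thesis by simp
next
  case False
  then have "{w. adj v w} \<noteq> {}" unfolding deg_def by force
  then have "v \<in> V" using adj_V by auto
  then have *: "deg v * (deg v - 1) \<le> 2 * R ^ 4" using sum_deg_cherries[of "{v}"] by simp
  show ?thesis
  proof (rule ccontr)
    assume "\<not> ?thesis"
    then have a: "2 * R ^ 2 < deg v" by simp
    have b: "1 \<le> R ^ 2" using R by simp
    \<comment> \<open>The second factor satisfies
      \<open>deg v - 1 > 2 * R ^ 2 - 1 \<ge> R ^ 2\<close> because \<open>1 \<le> R\<close>.\<close>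
    have "2 * R ^ 2 * (R ^ 2) < deg v * (deg v - 1)"
      using a b by (intro mult_strict_mono) auto
    then show False using * by (simp add: power2_eq_square power4_eq_xxxx)
  qed
qed

definition high :: "'a set" where
  "high = {v \<in> V. 2 * R ^ 3 < deg v * (deg v - 1)}"

lemma high_V: "high \<subseteq> V" and finite_high: "finite high"
  using finV unfolding high_def by auto

text \<open>The threshold in \<open>high\<close> is the fraction \<open>1 / R\<close> of the bound
  on all ordered cherries.\<close>

lemma at_most_high: "at_most high R"
proof -
  have "real (card high) * (2 * R ^ 3) \<le> (\<Sum>v\<in>high. deg v * (deg v - 1))"
    by (rule sum_bounded_below) (simp add: high_def)
  also have "\<dots> \<le> R * (2 * R ^ 3)" using sum_deg_cherries[OF high_V] by (simp add: power_numeral_reduce)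
  finally have "real (card high) \<le> R" using R by (simp add: mult_le_cancel_right)
  then show ?thesis unfolding at_most_def using finite_high by simp
qed

lemma at_most_Sigma_nbrs:
  assumes "finite W" "(\<Sum>v\<in>W. deg v) \<le> b"
  shows "at_most {(v, w). v \<in> W \<and> adj v w} b"
proof -
  have "{(v, w). v \<in> W \<and> adj v w} = (SIGMA v:W. {w. adj v w})" by auto
  then show ?thesis using assms unfolding at_most_def deg_def by (simp add: finite_nbrs)
qed

text \<open>A high vertex has degree at least \<open>R + 1\<close>, for otherwise it would be the
  center of too few cherries. So its degree is at most \<open>deg v * (deg v - 1) / R\<close>, and
  these quantities sum to at most \<open>2 * R ^ 4 / R\<close>.\<close>

lemma at_most_high_nbrs: "at_most {(x, y). x \<in> high \<and> adj x y} (2 * R ^ 3)"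
proof (rule at_most_Sigma_nbrs[OF finite_high])
  have "deg v * R \<le> deg v * (deg v - 1)" if "v \<in> high" for v
  proof -
    have "R \<le> deg v - 1"
    proof (rule ccontr)
      assume "\<not> ?thesis"
      moreover have "1 \<le> deg v" using that deg_cases[of v] R unfolding high_def by auto
      ultimately have "deg v * (deg v - 1) \<le> (R + 1) * R"
        using R by (intro mult_mono) auto
      also have "\<dots> \<le> 2 * R ^ 2" using R by (simp add: algebra_simps power2_eq_square)
      also have "\<dots> \<le> 2 * R ^ 3" using R by (simp add: power_increasing)
      finally show False using that unfolding high_def by simp
    qed
    then show ?thesis using deg_nonneg by (intro mult_left_mono) auto
  qed
  then have "(\<Sum>v\<in>high. deg v) * R \<le> (\<Sum>v\<in>high. deg v * (deg v - 1))"
    unfolding sum_distrib_right by (intro sum_mono)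
  also have "\<dots> \<le> (2 * R ^ 3) * R" using sum_deg_cherries[OF high_V] by (simp add: power_numeral_reduce)
  finally show "(\<Sum>v\<in>high. deg v) \<le> 2 * R ^ 3" using R by simp
qed

lemma n_ge: "R ^ j \<le> real n" if "j \<le> 3"
proof -
  have "R ^ j \<le> R ^ 3" using R that by (intro power_increasing) auto
  moreover have "0 \<le> R ^ 3" using R by simp
  ultimately show ?thesis using n_R by linarith
qed

text \<open>From \<open>deg v \<le> 1 + deg v * (deg v - 1)\<close> the degree sum is at most
  \<open>n + 2 * R ^ 4\<close>. Both terms are at most \<open>n * R\<close>, the second since
  \<open>R ^ 3\<close> is small compared with \<open>n\<close>.\<close>

lemma at_most_arcs: "at_most {(u, v). adj u v} (2 * real n * R)"
proof -
  have "(\<Sum>v\<in>V. deg v) \<le> (\<Sum>v\<in>V. 1 + deg v * (deg v - 1))"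
  proof (rule sum_mono)
    fix v
    have "0 \<le> (deg v - 1)\<^sup>2" by simp
    then show "deg v \<le> 1 + deg v * (deg v - 1)" by (simp add: power2_eq_square algebra_simps)
  qed
  also have "\<dots> \<le> real n + 2 * R ^ 4" using sum_deg_cherries[of V] cardV by (simp add: sum.distrib)
  also have "\<dots> \<le> real n * R + real n * R"
  proof -
    have "2 * R ^ 3 * R \<le> real n * R" using n_R R n_ge[of 3] by (intro mult_right_mono) auto
    moreover have "real n * 1 \<le> real n * R" using R by (intro mult_left_mono) auto
    ultimately show ?thesis by (simp add: power_numeral_reduce algebra_simps)
  qed
  finally have "at_most {(v, w). v \<in> V \<and> adj v w} (2 * real n * R)"
    by (intro at_most_Sigma_nbrs finV) (simp add: mult_ac)
  then show ?thesis by (rule at_most_mono) (auto dest: adj_V)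
qed

text \<open>Splitting at degree \<open>R\<close> gives
  \<open>deg v \<le> R + deg v * (deg v - 1) / R\<close> for each neighbor \<open>v\<close> of
  \<open>x\<close>. Each of the two terms sums to at most \<open>2 * R ^ 3\<close>, by the degree
  bound for \<open>x\<close> and by the cherry bound. Walks that return to \<open>x\<close> are
  included.\<close>

lemma at_most_paths_from: "at_most {(y, z). adj x y \<and> adj y z} (4 * R ^ 3)"
proof -
  have *: "deg v \<le> R + deg v * (deg v - 1) / R" for v
  proof (cases "deg v \<le> R")
    case True
    then show ?thesis using deg_cherries_nonneg[of v] R
      by (simp add: add_increasing2)
  next
    case False
    then have "R * (deg v - 1) \<le> deg v * (deg v - 1)" using R by (intro mult_right_mono) auto
    then have "deg v - 1 \<le> deg v * (deg v - 1) / R" using R by (simp add: field_simps)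
    then show ?thesis using R by simp
  qed
  have "(\<Sum>v | adj x v. deg v) \<le> (\<Sum>v | adj x v. R + deg v * (deg v - 1) / R)"
    by (intro sum_mono *)
  also have "\<dots> = deg x * R + (\<Sum>v | adj x v. deg v * (deg v - 1)) / R"
    by (simp add: sum.distrib deg_def sum_divide_distrib)
  also have "\<dots> \<le> 2 * R ^ 2 * R + 2 * R ^ 4 / R"
    using R by (intro add_mono mult_right_mono divide_right_mono deg_le sum_deg_cherries) (auto dest: adj_V2)
  also have "\<dots> = 4 * R ^ 3" using R by (simp add: power_numeral_reduce)
  finally have "at_most {(v, w). v \<in> {v. adj x v} \<and> adj v w} (4 * R ^ 3)"
    by (intro at_most_Sigma_nbrs finite_nbrs)
  then show ?thesis by simp
qed

lemma deg_low: "v \<in> V - high \<Longrightarrow> deg v * (deg v - 1) \<le> 2 * R ^ 3"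
  unfolding high_def by auto

text \<open>As \<open>v\<close> and its neighbor \<open>z\<close> are both low, comparison with the
  one of larger degree gives \<open>deg v * (deg z - 1) \<le> 2 * R ^ 3\<close>. So each of the at
  most \<open>deg v\<close> choices of \<open>z\<close> leaves at most
  \<open>2 * R ^ 3 / deg v\<close> choices of \<open>w\<close>.\<close>

lemma at_most_low_paths_from:
  assumes "v \<in> V - high"
  shows "at_most {(z, w). z \<in> V - high \<and> adj v z \<and> adj z w \<and> w \<noteq> v} (2 * R ^ 3)"
proof (cases "deg v = 0")
  case True
  then have "{w. adj v w} = {}" unfolding deg_def using finite_nbrs by simp
  then have "{(z, w). z \<in> V - high \<and> adj v z \<and> adj z w \<and> w \<noteq> v} = {}" by blast
  then show ?thesis unfolding at_most_def by (simp only:) (use R in simp)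
next
  case False
  then have v1: "1 \<le> deg v" using deg_cases by auto
  have fibre: "at_most {w. adj z w \<and> w \<noteq> v} (2 * R ^ 3 / deg v)" if z: "z \<in> V - high" "adj v z" for z
  proof -
    have "{w. adj z w \<and> w \<noteq> v} = {w. adj z w} - {v}" by auto
    moreover have "v \<in> {w. adj z w}" using adj_sym[OF z(2)] by simp
    moreover from this have "card {w. adj z w} > 0" using finite_nbrs[of z] card_gt_0_iff by blast
    ultimately have card: "real (card {w. adj z w \<and> w \<noteq> v}) = deg z - 1"
      unfolding deg_def by (simp only: card_Diff_singleton)
    moreover have "deg z - 1 \<le> 2 * R ^ 3 / deg v"
    proof -
      have z0: "0 \<le> deg z - 1" using card by (metis of_nat_0_le_iff)
      have "deg v * (deg z - 1) \<le> 2 * R ^ 3"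
      proof (cases "deg v \<le> deg z")
        case True
        then have "deg v * (deg z - 1) \<le> deg z * (deg z - 1)" using z0 by (intro mult_right_mono) auto
        then show ?thesis using deg_low[OF z(1)] by simp
      next
        case False
        then have "deg v * (deg z - 1) \<le> deg v * (deg v - 1)" using v1 by (intro mult_left_mono) auto
        then show ?thesis using deg_low[OF assms] by simp
      qed
      then show ?thesis using v1 by (simp add: field_simps)
    qed
    ultimately show ?thesis unfolding at_most_def using card finite_nbrs[of z] by simp
  qed
  have "at_most (SIGMA z:{z \<in> V - high. adj v z}. {w. adj z w \<and> w \<noteq> v}) (deg v * (2 * R ^ 3 / deg v))"
    by (rule at_most_Sigma[OF at_most_mono[OF at_most_nbrs]]) (use fibre R v1 in auto)
  then show ?thesis using v1 by (elim at_most_mono) auto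
qed

end

section \<open>Bounded colorings and the greedy choice of images for the high vertices\<close>

locale bounded_coloring =
  fixes n :: nat and col :: "nat \<Rightarrow> nat \<Rightarrow> 'c" and k R :: real
  assumes col_sym: "col u v = col v u"
    and k: "1 \<le> k" and R1: "1 \<le> R" and kRn: "1512 * (k * R ^ 3) \<le> real n"
    and class_arcs: "at_most {(u, v). u < n \<and> v < n \<and> u \<noteq> v \<and> col u v = a} (2 * k)"
    and class_star: "u < n \<Longrightarrow> at_most {v. v < n \<and> u \<noteq> v \<and> col u v = a} k"
begin

text \<open>For \<open>u \<noteq> v\<close> these are the centers of the monochromatic cherries of
  \<open>K\<^sub>n\<close> with leaves \<open>u\<close> and \<open>v\<close>.\<close>

definition codeg :: "nat \<Rightarrow> nat \<Rightarrow> nat set" where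
  "codeg u v = {y. y < n \<and> y \<noteq> u \<and> y \<noteq> v \<and> col u y = col v y}"

text \<open>Double counting of the pairs \<open>(v, y)\<close> with \<open>y\<close> in
  \<open>codeg u v\<close>: for each \<open>y\<close> the vertices \<open>v\<close> form a star of
  one color at \<open>y\<close>, so there are at most \<open>n * k\<close> pairs.\<close>

lemma at_most_large_codeg:
  assumes "u < n"
  shows "at_most {v. v < n \<and> \<not> at_most (codeg u v) (2 * R * k)} (real n / (2 * R))"
proof -
  let ?S = "{v. v < n \<and> \<not> at_most (codeg u v) (2 * R * k)}"
  have fin: "finite (codeg u v)" for v unfolding codeg_def by simp
  have "at_most (SIGMA y:{y. y < n \<and> y \<noteq> u}. {v. v < n \<and> y \<noteq> v \<and> col y v = col u y}) (real n * k)"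
  proof (rule at_most_Sigma)
    show "at_most {y. y < n \<and> y \<noteq> u} (real n)"
      by (rule at_most_mono[of "{..<n}"]) (auto simp: at_most_def)
  qed (use class_star k in auto)
  then have "at_most ((\<lambda>(v, y). (y, v)) ` Sigma ?S (codeg u)) (real n * k)"
    by (rule at_most_mono) (auto simp: codeg_def col_sym)
  then have "at_most (Sigma ?S (codeg u)) (real n * k)"
    by (rule at_most_inj_image) (auto simp: inj_on_def)
  then have "(\<Sum>v\<in>?S. real (card (codeg u v))) \<le> real n * k"
    unfolding at_most_def using fin by (subst (asm) card_SigmaI) auto
  moreover have "real (card ?S) * (2 * R * k) \<le> (\<Sum>v\<in>?S. real (card (codeg u v)))"
    by (rule sum_bounded_below) (use fin in \<open>auto simp: at_most_def\<close>)
  ultimately have "real (card ?S) * (2 * R) * k \<le> real n * k" by (simp add: mult.assoc)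
  then have "real (card ?S) * (2 * R) \<le> real n" using k by simp
  then show ?thesis unfolding at_most_def using R1 by (simp add: field_simps)
qed

definition spread :: "nat set \<Rightarrow> bool" where
  "spread U \<longleftrightarrow> U \<subseteq> {..<n} \<and> (\<forall>u\<in>U. \<forall>v\<in>U. u \<noteq> v \<longrightarrow> at_most (codeg u v) (2 * R * k)) \<and>
     (\<forall>a\<in>U. \<forall>b\<in>U. \<forall>p\<in>U. \<forall>q\<in>U. a \<noteq> b \<and> p \<noteq> q \<and> {a, b} \<noteq> {p, q} \<longrightarrow> col a b \<noteq> col p q)"

lemma spread_rainbow:
  "spread U \<Longrightarrow> a \<in> U \<Longrightarrow> b \<in> U \<Longrightarrow> p \<in> U \<Longrightarrow> q \<in> U \<Longrightarrow> a \<noteq> b \<Longrightarrow> p \<noteq> q \<Longrightarrow> {a, b} \<noteq> {p, q} \<Longrightarrow>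
    col a b \<noteq> col p q"
  unfolding spread_def by simp

definition colors :: "nat set \<Rightarrow> 'c set" where
  "colors U = {col u v | u v. u \<in> U \<and> v \<in> U \<and> u \<noteq> v}"

text \<open>Such a \<open>y\<close> must not be added to a spread set \<open>U\<close>, and if
  \<open>U\<close> is the image of \<open>high\<close>, it is a forbidden image for the neighbors of
  high vertices. All edges from \<open>U\<close> to \<open>y\<close> are considered, whether or not
  they come from edges of the graph, so that one set serves both uses.\<close>

definition bad :: "nat set \<Rightarrow> nat set" where
  "bad U = {y. y < n \<and> y \<notin> U \<and> ((\<exists>u\<in>U. col u y \<in> colors U) \<or> (\<exists>u\<in>U. \<exists>v\<in>U. u \<noteq> v \<and> col u y = col v y))}"

lemma at_most_colors:
  assumes "at_most U R"
  shows "at_most (colors U) (R ^ 2)"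
proof -
  have "at_most ((\<lambda>(u, v). col u v) ` (U \<times> U)) (R * R)"
    by (intro at_most_image at_most_Sigma) (use assms R1 in auto)
  then show ?thesis by (rule at_most_mono) (auto simp: colors_def power2_eq_square)
qed

text \<open>The first clause of \<open>bad\<close> is paid for by at most \<open>R ^ 2\<close>
  colors with \<open>2 * k\<close> arcs each. For the second there are at most \<open>R ^ 2\<close>
  pairs in \<open>U\<close> with \<open>2 * R * k\<close> vertices each; this is the purpose of the
  codegree bound in \<open>spread\<close>.\<close>

lemma at_most_bad:
  assumes "spread U" "at_most U R"
  shows "at_most (bad U) (4 * (k * R ^ 3))"
proof -
  have U: "U \<subseteq> {..<n}" using assms(1) unfolding spread_def by simp
  have 1: "at_most (\<Union>a\<in>colors U. snd ` {(u, v). u < n \<and> v < n \<and> u \<noteq> v \<and> col u v = a}) (R ^ 2 * (2 * k))"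
    by (intro at_most_UN at_most_colors at_most_image class_arcs assms) (use k in auto)
  have 2: "at_most (\<Union>(u, v)\<in>{(u, v). u \<in> U \<and> v \<in> U \<and> u \<noteq> v}. codeg u v) ((R * R) * (2 * R * k))"
  proof (rule at_most_UN)
    show "at_most {(u, v). u \<in> U \<and> v \<in> U \<and> u \<noteq> v} (R * R)"
      by (rule at_most_mono[of "U \<times> U"]) (use at_most_Sigma[of U R "\<lambda>_. U" R] assms R1 in auto)
  qed (use assms(1) k R1 in \<open>auto simp: spread_def\<close>)
  have "at_most (bad U) (R ^ 2 * (2 * k) + (R * R) * (2 * R * k))"
  proof (rule at_most_mono[OF at_most_Un[OF 1 2]])
    show "bad U \<subseteq> (\<Union>a\<in>colors U. snd ` {(u, v). u < n \<and> v < n \<and> u \<noteq> v \<and> col u v = a})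
        \<union> (\<Union>(u, v)\<in>{(u, v). u \<in> U \<and> v \<in> U \<and> u \<noteq> v}. codeg u v)"
      (is "_ \<subseteq> ?S \<union> ?T")
    proof
      fix y assume y: "y \<in> bad U"
      then have yn: "y < n" "y \<notin> U" unfolding bad_def by auto
      from y consider u where "u \<in> U" "col u y \<in> colors U"
        | u v where "u \<in> U" "v \<in> U" "u \<noteq> v" "col u y = col v y" unfolding bad_def by blast
      then show "y \<in> ?S \<union> ?T"
      proof cases
        case 1
        then have "(u, y) \<in> {(u', v). u' < n \<and> v < n \<and> u' \<noteq> v \<and> col u' v = col u y}" using yn U by auto
        then show ?thesis using 1(2) by (intro UnI1 UN_I[of "col u y"]) (auto intro!: image_eqI[of _ _ "(u, y)"])
      next
        case 2
        then show ?thesis using yn U unfolding codeg_def by (intro UnI2 UN_I[of "(u, v)"]) auto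
      qed
    qed
  qed simp
  moreover have "R ^ 2 * k \<le> R ^ 3 * k" using R1 k by (intro mult_right_mono power_increasing) auto
  ultimately show ?thesis by (elim at_most_mono) (auto simp: power_numeral_reduce algebra_simps)
qed

lemma spread_insert:
  assumes U: "spread U" and v: "v < n" "v \<notin> U" "v \<notin> bad U"
    and cd: "\<And>u. u \<in> U \<Longrightarrow> at_most (codeg u v) (2 * R * k)"
  shows "spread (insert v U)"
proof -
  have cs: "codeg u w = codeg w u" for u w unfolding codeg_def by auto
  have nb1: "col u v \<notin> colors U" if "u \<in> U" for u using v that unfolding bad_def by auto
  have nb2: "col u v \<noteq> col w v" if "u \<in> U" "w \<in> U" "u \<noteq> w" for u w using v that unfolding bad_def by blast
  have inC: "col u w \<in> colors U" if "u \<in> U" "w \<in> U" "u \<noteq> w" for u w using that unfolding colors_def by blast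
  have "col a b \<noteq> col p q" if h: "a \<in> insert v U" "b \<in> insert v U" "p \<in> insert v U" "q \<in> insert v U"
    "a \<noteq> b" "p \<noteq> q" "{a, b} \<noteq> {p, q}" for a b p q
  proof -
    \<comment> \<open>By symmetry of \<open>col\<close> each pair can be written with its first
      vertex in \<open>U\<close>, so that only the second may be \<open>v\<close>.\<close>
    have norm: "\<exists>a' b'. {a, b} = {a', b'} \<and> col a b = col a' b' \<and> a' \<in> U \<and> b' \<in> insert v U \<and> a' \<noteq> b'"
      if "a \<in> insert v U" "b \<in> insert v U" "a \<noteq> b" for a b
    proof (cases "a = v")
      case True
      then show ?thesis using that by (intro exI[of _ b] exI[of _ a]) (auto simp: col_sym)
    next
      case False
      then show ?thesis using that by blast
    qed
    obtain a' b' where ab: "{a, b} = {a', b'}" "col a b = col a' b'" "a' \<in> U" "b' \<in> insert v U" "a' \<noteq> b'"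
      using norm[of a b] h by blast
    obtain p' q' where pq: "{p, q} = {p', q'}" "col p q = col p' q'" "p' \<in> U" "q' \<in> insert v U" "p' \<noteq> q'"
      using norm[of p q] h by blast
    have ne: "{a', b'} \<noteq> {p', q'}" using h ab(1) pq(1) by simp
    consider "b' = v" "q' = v" | "b' = v" "q' \<in> U" | "b' \<in> U" "q' = v" | "b' \<in> U" "q' \<in> U"
      using ab pq by blast
    then have "col a' b' \<noteq> col p' q'"
    proof cases
      case 1
      then show ?thesis using nb2[of a' p'] ab pq ne by blast
    next
      case 2
      then show ?thesis using nb1[of a'] inC[of p' q'] ab pq by metis
    next
      case 3
      then show ?thesis using nb1[of p'] inC[of a' b'] ab pq by metis
    next
      case 4
      then show ?thesis using spread_rainbow[OF U ab(3) _ pq(3) _ ab(5) pq(5) ne] by simp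
    qed
    then show ?thesis using ab pq by simp
  qed
  moreover have "at_most (codeg u w) (2 * R * k)" if "u \<in> insert v U" "w \<in> insert v U" "u \<noteq> w" for u w
  proof -
    have "at_most (codeg u w) (2 * R * k)" if "u \<in> U" "w \<in> U" "u \<noteq> w" for u w
      using U that unfolding spread_def by simp
    then show ?thesis using that cd cs[of v w] by auto
  qed
  ultimately show ?thesis using U v unfolding spread_def by auto
qed

text \<open>Greedy choice. The codegree threshold \<open>2 * R * k\<close> makes the vertices of
  large codegree with some vertex of \<open>U\<close> number at most \<open>n / 2\<close>. The set
  \<open>U\<close> and its bad vertices exclude at most \<open>5 * k * R ^ 3\<close> more, so a
  vertex remains.\<close>

lemma exists_spread: "real m \<le> R \<Longrightarrow> \<exists>U. spread U \<and> card U = m"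
proof (induction m)
  case 0
  have "spread {}" unfolding spread_def by simp
  then show ?case by (metis card.empty)
next
  case (Suc m)
  then obtain U where U: "spread U" "card U = m" by auto
  have finU: "finite U" using U(1) unfolding spread_def by (meson finite_lessThan finite_subset)
  have Um: "at_most U R" unfolding at_most_def using finU U(2) Suc.prems by simp
  have Un: "U \<subseteq> {..<n}" using U(1) unfolding spread_def by simp
  let ?X = "U \<union> bad U \<union> (\<Union>u\<in>U. {v. v < n \<and> \<not> at_most (codeg u v) (2 * R * k)})"
  have X: "at_most ?X (R + 4 * (k * R ^ 3) + R * (real n / (2 * R)))"
    by (intro at_most_Un at_most_UN Um at_most_bad U at_most_large_codeg) (use Un R1 in auto)
  have "R \<le> k * R ^ 3"
    using mult_mono[of 1 k "R ^ 1" "R ^ 3"] power_increasing[of 1 3 R] R1 k by auto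
  moreover have "R * (real n / (2 * R)) = real n / 2" using R1 by simp
  moreover have "0 < k * R ^ 3" using k R1 by simp
  ultimately have "R + 4 * (k * R ^ 3) + R * (real n / (2 * R)) < real n"
    using kRn by linarith
  then have "real (card ?X) < real n" using X unfolding at_most_def by linarith
  then have "card ?X < card {..<n}" by simp
  then have "\<not> {..<n} \<subseteq> ?X" using X unfolding at_most_def by (meson card_mono not_le)
  then obtain v where "v < n" "v \<notin> U" "v \<notin> bad U" "\<And>u. u \<in> U \<Longrightarrow> at_most (codeg u v) (2 * R * k)"
    by blast
  then have "spread (insert v U)" "card (insert v U) = Suc m"
    using spread_insert U finU by auto
  then show ?case by blast
qed

end

section \<open>Families of matchings with two to four pairs given by predicates\<close>

definition pairs :: "('a \<Rightarrow> 'a \<Rightarrow> 'b \<Rightarrow> 'b \<Rightarrow> bool) \<Rightarrow> ('a \<times> 'b) set set" where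
  "pairs P = {{(y, y'), (z, z')} | y z y' z'. P y z y' z'}"

definition triples :: "('a \<Rightarrow> 'a \<Rightarrow> 'a \<Rightarrow> 'b \<Rightarrow> 'b \<Rightarrow> 'b \<Rightarrow> bool) \<Rightarrow> ('a \<times> 'b) set set" where
  "triples P = {{(y, y'), (z, z'), (w, w')} | y z w y' z' w'. P y z w y' z' w'}"

definition quads :: "('a \<Rightarrow> 'a \<Rightarrow> 'a \<Rightarrow> 'a \<Rightarrow> 'b \<Rightarrow> 'b \<Rightarrow> 'b \<Rightarrow> 'b \<Rightarrow> bool) \<Rightarrow> ('a \<times> 'b) set set" where
  "quads P = {{(y, y'), (z, z'), (v, v'), (w, w')} | y z v w y' z' v' w'. P y z v w y' z' v' w'}"

lemma pairs_dom:
  assumes "at_most {(z, y', z'). P t z y' z'} a" "at_most {(y, y', z'). P y t y' z'} b"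
  shows "at_most {M \<in> pairs P. t \<in> fst ` M} (a + b)"
proof (rule at_most_mono[OF at_most_Un[OF at_most_image[OF assms(1)] at_most_image[OF assms(2)]]])
  show "{M \<in> pairs P. t \<in> fst ` M} \<subseteq>
      (\<lambda>(z, y', z'). {(t, y'), (z, z')}) ` {(z, y', z'). P t z y' z'} \<union>
      (\<lambda>(y, y', z'). {(y, y'), (t, z')}) ` {(y, y', z'). P y t y' z'}"
    unfolding pairs_def by (auto simp: image_iff) blast+
qed simp

lemma pairs_ran:
  assumes "at_most {(y, z, z'). P y z t z'} a" "at_most {(y, z, y'). P y z y' t} b"
  shows "at_most {M \<in> pairs P. t \<in> snd ` M} (a + b)"
proof (rule at_most_mono[OF at_most_Un[OF at_most_image[OF assms(1)] at_most_image[OF assms(2)]]])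
  show "{M \<in> pairs P. t \<in> snd ` M} \<subseteq>
      (\<lambda>(y, z, z'). {(y, t), (z, z')}) ` {(y, z, z'). P y z t z'} \<union>
      (\<lambda>(y, z, y'). {(y, y'), (z, t)}) ` {(y, z, y'). P y z y' t}"
    unfolding pairs_def by (auto simp: image_iff)
qed simp

text \<open>When \<open>P\<close> is invariant under exchanging its two vertices, \<open>t\<close>
  may be taken to be the first, which saves the second summand of \<open>pairs_dom\<close>.\<close>

lemma pairs_dom_sym:
  assumes sym: "\<And>y z y' z'. P y z y' z' \<Longrightarrow> P z y z' y'"
    and "at_most {(z, y', z'). P t z y' z'} a"
  shows "at_most {M \<in> pairs P. t \<in> fst ` M} a"
proof (rule at_most_mono[OF at_most_image[OF assms(2)]])
  show "{M \<in> pairs P. t \<in> fst ` M} \<subseteq> (\<lambda>(z, y', z'). {(t, y'), (z, z')}) ` {(z, y', z'). P t z y' z'}"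
  proof
    fix M assume "M \<in> {M \<in> pairs P. t \<in> fst ` M}"
    then obtain y z y' z' where M: "M = {(y, y'), (z, z')}" "P y z y' z'" "t \<in> fst ` M"
      unfolding pairs_def by blast
    then have "\<exists>z y' z'. P t z y' z' \<and> M = {(t, y'), (z, z')}" using sym[OF M(2)] by auto
    then show "M \<in> (\<lambda>(z, y', z'). {(t, y'), (z, z')}) ` {(z, y', z'). P t z y' z'}"
      by (auto simp: image_iff)
  qed
qed simp

lemma pairs_ran_sym:
  assumes sym: "\<And>y z y' z'. P y z y' z' \<Longrightarrow> P z y z' y'"
    and "at_most {(y, z, z'). P y z t z'} a"
  shows "at_most {M \<in> pairs P. t \<in> snd ` M} a"
proof (rule at_most_mono[OF at_most_image[OF assms(2)]])
  show "{M \<in> pairs P. t \<in> snd ` M} \<subseteq> (\<lambda>(y, z, z'). {(y, t), (z, z')}) ` {(y, z, z'). P y z t z'}"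
  proof
    fix M assume "M \<in> {M \<in> pairs P. t \<in> snd ` M}"
    then obtain y z y' z' where M: "M = {(y, y'), (z, z')}" "P y z y' z'" "t \<in> snd ` M"
      unfolding pairs_def by blast
    then have "\<exists>y z z'. P y z t z' \<and> M = {(y, t), (z, z')}" using sym[OF M(2)] by auto
    then show "M \<in> (\<lambda>(y, z, z'). {(y, t), (z, z')}) ` {(y, z, z'). P y z t z'}"
      by (auto simp: image_iff)
  qed
qed simp

text \<open>The symmetry exchanges the last two vertices only, so two roles of \<open>t\<close>
  remain: the distinguished vertex \<open>y\<close>, or one of the other two.\<close>

lemma triples_dom_sym:
  assumes sym: "\<And>y z w y' z' w'. P y z w y' z' w' \<Longrightarrow> P y w z y' w' z'"
    and "at_most {(z, w, y', z', w'). P t z w y' z' w'} a"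
    and "at_most {(y, w, y', z', w'). P y t w y' z' w'} b"
  shows "at_most {M \<in> triples P. t \<in> fst ` M} (a + b)"
proof (rule at_most_mono[OF at_most_Un[OF at_most_image[OF assms(2)] at_most_image[OF assms(3)]]])
  let ?A = "(\<lambda>(z, w, y', z', w'). {(t, y'), (z, z'), (w, w')}) ` {(z, w, y', z', w'). P t z w y' z' w'}"
  let ?B = "(\<lambda>(y, w, y', z', w'). {(y, y'), (t, z'), (w, w')}) ` {(y, w, y', z', w'). P y t w y' z' w'}"
  show "{M \<in> triples P. t \<in> fst ` M} \<subseteq> ?A \<union> ?B"
  proof
    fix M assume "M \<in> {M \<in> triples P. t \<in> fst ` M}"
    then obtain y z w y' z' w' where M: "M = {(y, y'), (z, z'), (w, w')}" "P y z w y' z' w'" "t \<in> fst ` M"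
      unfolding triples_def by blast
    then consider "t = y" | "t = z" | "t = w" by auto
    then show "M \<in> ?A \<union> ?B"
    proof cases
      case 1
      then have "(z, w, y', z', w') \<in> {(z, w, y', z', w'). P t z w y' z' w'}" using M by simp
      then show ?thesis using M 1 by (intro UnI1 image_eqI[of _ _ "(z, w, y', z', w')"]) auto
    next
      case 2
      then have "(y, w, y', z', w') \<in> {(y, w, y', z', w'). P y t w y' z' w'}" using M by simp
      then show ?thesis using M 2 by (intro UnI2 image_eqI[of _ _ "(y, w, y', z', w')"]) auto
    next
      case 3
      then have "(y, z, y', w', z') \<in> {(y, w, y', z', w'). P y t w y' z' w'}" using sym M by simp
      then show ?thesis using M 3 by (intro UnI2 image_eqI[of _ _ "(y, z, y', w', z')"]) auto
    qed
  qed
qed simp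

lemma triples_ran_sym:
  assumes sym: "\<And>y z w y' z' w'. P y z w y' z' w' \<Longrightarrow> P y w z y' w' z'"
    and "at_most {(y, z, w, z', w'). P y z w t z' w'} a"
    and "at_most {(y, z, w, y', w'). P y z w y' t w'} b"
  shows "at_most {M \<in> triples P. t \<in> snd ` M} (a + b)"
proof (rule at_most_mono[OF at_most_Un[OF at_most_image[OF assms(2)] at_most_image[OF assms(3)]]])
  let ?A = "(\<lambda>(y, z, w, z', w'). {(y, t), (z, z'), (w, w')}) ` {(y, z, w, z', w'). P y z w t z' w'}"
  let ?B = "(\<lambda>(y, z, w, y', w'). {(y, y'), (z, t), (w, w')}) ` {(y, z, w, y', w'). P y z w y' t w'}"
  show "{M \<in> triples P. t \<in> snd ` M} \<subseteq> ?A \<union> ?B"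
  proof
    fix M assume "M \<in> {M \<in> triples P. t \<in> snd ` M}"
    then obtain y z w y' z' w' where M: "M = {(y, y'), (z, z'), (w, w')}" "P y z w y' z' w'" "t \<in> snd ` M"
      unfolding triples_def by blast
    then consider "t = y'" | "t = z'" | "t = w'" by auto
    then show "M \<in> ?A \<union> ?B"
    proof cases
      case 1
      then have "(y, z, w, z', w') \<in> {(y, z, w, z', w'). P y z w t z' w'}" using M by simp
      then show ?thesis using M 1 by (intro UnI1 image_eqI[of _ _ "(y, z, w, z', w')"]) auto
    next
      case 2
      then have "(y, z, w, y', w') \<in> {(y, z, w, y', w'). P y z w y' t w'}" using M by simp
      then show ?thesis using M 2 by (intro UnI2 image_eqI[of _ _ "(y, z, w, y', w')"]) auto
    next
      case 3
      then have "(y, w, z, y', z') \<in> {(y, z, w, y', w'). P y z w y' t w'}" using sym M by simp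
      then show ?thesis using M 3 by (intro UnI2 image_eqI[of _ _ "(y, w, z, y', z')"]) auto
    qed
  qed
qed simp

text \<open>One symmetry reverses the first edge and the other exchanges the two edges. Together
  they move any of the four positions to the first, so one count suffices.\<close>

lemma quads_dom_sym:
  assumes sym: "\<And>y z v w y' z' v' w'. P y z v w y' z' v' w' \<Longrightarrow> P z y v w z' y' v' w'"
      "\<And>y z v w y' z' v' w'. P y z v w y' z' v' w' \<Longrightarrow> P v w y z v' w' y' z'"
    and "at_most {(z, v, w, y', z', v', w'). P t z v w y' z' v' w'} a"
  shows "at_most {M \<in> quads P. t \<in> fst ` M} a"
proof (rule at_most_mono[OF at_most_image[OF assms(3)]])
  let ?f = "\<lambda>(z, v, w, y', z', v', w'). {(t, y'), (z, z'), (v, v'), (w, w')}"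
  show "{M \<in> quads P. t \<in> fst ` M} \<subseteq> ?f ` {(z, v, w, y', z', v', w'). P t z v w y' z' v' w'}"
  proof
    fix M assume "M \<in> {M \<in> quads P. t \<in> fst ` M}"
    then obtain y z v w y' z' v' w' where M: "M = {(y, y'), (z, z'), (v, v'), (w, w')}"
      "P y z v w y' z' v' w'" "t \<in> fst ` M"
      unfolding quads_def by blast
    note s = sym(1)[OF M(2)] sym(2)[OF M(2)] sym(1)[OF sym(2)[OF M(2)]]
    from M consider "t = y" | "t = z" | "t = v" | "t = w" by auto
    then have "\<exists>z v w y' z' v' w'. P t z v w y' z' v' w' \<and> M = {(t, y'), (z, z'), (v, v'), (w, w')}"
    proof cases
      case 1
      then show ?thesis using M by blast
    next
      case 2
      have "M = {(z, z'), (y, y'), (v, v'), (w, w')}" using M by auto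
      then show ?thesis using s(1) 2 by blast
    next
      case 3
      have "M = {(v, v'), (w, w'), (y, y'), (z, z')}" using M by auto
      then show ?thesis using s(2) 3 by blast
    next
      case 4
      have "M = {(w, w'), (v, v'), (y, y'), (z, z')}" using M by auto
      then show ?thesis using s(3) 4 by blast
    qed
    then show "M \<in> ?f ` {(z, v, w, y', z', v', w'). P t z v w y' z' v' w'}"
      by (auto simp: image_iff)
  qed
qed simp

lemma quads_ran_sym:
  assumes sym: "\<And>y z v w y' z' v' w'. P y z v w y' z' v' w' \<Longrightarrow> P z y v w z' y' v' w'"
      "\<And>y z v w y' z' v' w'. P y z v w y' z' v' w' \<Longrightarrow> P v w y z v' w' y' z'"
    and "at_most {(y, z, v, w, z', v', w'). P y z v w t z' v' w'} a"
  shows "at_most {M \<in> quads P. t \<in> snd ` M} a"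
proof (rule at_most_mono[OF at_most_image[OF assms(3)]])
  let ?f = "\<lambda>(y, z, v, w, z', v', w'). {(y, t), (z, z'), (v, v'), (w, w')}"
  show "{M \<in> quads P. t \<in> snd ` M} \<subseteq> ?f ` {(y, z, v, w, z', v', w'). P y z v w t z' v' w'}"
  proof
    fix M assume "M \<in> {M \<in> quads P. t \<in> snd ` M}"
    then obtain y z v w y' z' v' w' where M: "M = {(y, y'), (z, z'), (v, v'), (w, w')}"
      "P y z v w y' z' v' w'" "t \<in> snd ` M"
      unfolding quads_def by blast
    note s = sym(1)[OF M(2)] sym(2)[OF M(2)] sym(1)[OF sym(2)[OF M(2)]]
    from M consider "t = y'" | "t = z'" | "t = v'" | "t = w'" by auto
    then have "\<exists>y z v w z' v' w'. P y z v w t z' v' w' \<and> M = {(y, t), (z, z'), (v, v'), (w, w')}"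
    proof cases
      case 1
      then show ?thesis using M by blast
    next
      case 2
      have "M = {(z, z'), (y, y'), (v, v'), (w, w')}" using M by auto
      then show ?thesis using s(1) 2 by blast
    next
      case 3
      have "M = {(v, v'), (w, w'), (y, y'), (z, z')}" using M by auto
      then show ?thesis using s(2) 3 by blast
    next
      case 4
      have "M = {(w, w'), (v, v'), (y, y'), (z, z')}" using M by auto
      then show ?thesis using s(3) 4 by blast
    qed
    then show "M \<in> ?f ` {(y, z, v, w, z', v', w'). P y z v w t z' v' w'}"
      by (auto simp: image_iff)
  qed
qed simp

subsection \<open>Bad events\<close>

locale partial_embedding = few_cherries V adj n R + bounded_coloring n col k R
  for V :: "'a set" and adj n R and col :: "nat \<Rightarrow> nat \<Rightarrow> 'c" and k +
  fixes \<phi> :: "'a \<Rightarrow> nat"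
  assumes inj_\<phi>: "inj_on \<phi> high" and spread_\<phi>: "spread (\<phi> ` high)"
begin

abbreviation "U \<equiv> \<phi> ` high"
abbreviation "A \<equiv> V - high"
abbreviation "B \<equiv> {..<n} - \<phi> ` high"
abbreviation "cls a \<equiv> {(u, v). u < n \<and> v < n \<and> u \<noteq> v \<and> col u v = a}"
abbreviation "star u a \<equiv> {v. v < n \<and> u \<noteq> v \<and> col u v = a}"
abbreviation "K \<equiv> k * R ^ 3"

lemma \<phi>_less: "x \<in> high \<Longrightarrow> \<phi> x < n"
  using spread_\<phi> unfolding spread_def by auto

lemma at_most_U: "at_most U R"
  using at_most_image[OF at_most_high] .

lemma at_most_n: "at_most {..<n} (real n)"
  unfolding at_most_def by simp

lemma at_most_deg: "at_most {w. adj v w} (2 * R ^ 2)"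
  using at_most_mono[OF at_most_nbrs subset_refl deg_le] .

text \<open>As \<open>\<phi>\<close> is injective, \<open>x\<close> and \<open>v\<close> determine
  an arc of the color class. Counting them jointly avoids a factor for the number of high
  vertices.\<close>

lemma at_most_high_cls: "at_most {(x, v). x \<in> high \<and> v \<notin> U \<and> v < n \<and> col (\<phi> x) v = a} (2 * k)"
proof (rule at_most_inj_image[where f = "\<lambda>(x, v). (\<phi> x, v)"])
  show "at_most ((\<lambda>(x, v). (\<phi> x, v)) ` {(x, v). x \<in> high \<and> v \<notin> U \<and> v < n \<and> col (\<phi> x) v = a}) (2 * k)"
    by (rule at_most_mono[OF class_arcs[of a]]) (auto simp: \<phi>_less)
qed (use inj_\<phi> in \<open>auto simp: inj_on_def\<close>)

lemma at_most_high_star: "v < n \<Longrightarrow> v \<notin> U \<Longrightarrow> at_most {x. x \<in> high \<and> col (\<phi> x) v = a} k"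
proof (rule at_most_inj_image[where f = \<phi>])
  assume "v < n" "v \<notin> U"
  then show "at_most (\<phi> ` {x. x \<in> high \<and> col (\<phi> x) v = a}) k"
    by (intro at_most_mono[OF class_star[of v a]]) (auto simp: \<phi>_less col_sym)
qed (use inj_\<phi> in \<open>auto simp: inj_on_def\<close>)

lemma pow_bounds:
  "R * K \<le> real n * K" "R ^ 2 * K \<le> real n * K" "R ^ 3 * K \<le> real n * K" "K \<le> R * K" "R ^ 3 \<le> K"
  "0 \<le> K" "0 \<le> R" "0 \<le> k"
proof -
  show "0 \<le> K" "0 \<le> R" "0 \<le> k" using k R by auto
  then show "R * K \<le> real n * K" "R ^ 2 * K \<le> real n * K" "R ^ 3 * K \<le> real n * K"
    using n_ge[of 1] n_ge[of 2] n_ge[of 3] by (auto intro!: mult_right_mono)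
  show "K \<le> R * K" using \<open>0 \<le> K\<close> R mult_right_mono[of 1 R K] by simp
  show "R ^ 3 \<le> K" using k R mult_right_mono[of 1 k "R ^ 3"] by simp
qed

text \<open>The bad events for two edges of \<open>G\<close>, sorted by the number of vertices outside \<open>high\<close> on these
  edges: \<open>y\<close>, \<open>z\<close>, \<open>v\<close>, \<open>w\<close> are such vertices with images \<open>y'\<close>, \<open>z'\<close>, \<open>v'\<close>, \<open>w'\<close>, and \<open>x\<close> is a high
  vertex. In \<open>P2a\<close> one of the edges lies in \<open>high\<close>; \<open>P2b\<close> includes the cherries centered at a
  high vertex, \<open>P2c\<close> has the cherries with one high leaf, and in \<open>P3a\<close> the vertex \<open>y\<close> is the center.\<close>

definition E1 :: "('a \<times> nat) set set" where
  "E1 = {{(y, y')} | y y'. y \<in> A \<and> y' \<in> bad U \<and> (\<exists>x\<in>high. adj x y)}"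

definition P2a :: "'a \<Rightarrow> 'a \<Rightarrow> nat \<Rightarrow> nat \<Rightarrow> bool" where
  "P2a y z y' z' \<longleftrightarrow> y \<in> A \<and> z \<in> A \<and> y' \<in> B \<and> z' \<in> B \<and> y' \<noteq> z' \<and> adj y z \<and> col y' z' \<in> colors U"

definition P2b :: "'a \<Rightarrow> 'a \<Rightarrow> nat \<Rightarrow> nat \<Rightarrow> bool" where
  "P2b y z y' z' \<longleftrightarrow> y \<in> A \<and> z \<in> A \<and> y' \<in> B \<and> z' \<in> B \<and> y \<noteq> z \<and> y' \<noteq> z' \<and>
     (\<exists>x1\<in>high. \<exists>x2\<in>high. adj x1 y \<and> adj x2 z \<and> col (\<phi> x1) y' = col (\<phi> x2) z')"

definition P2c :: "'a \<Rightarrow> 'a \<Rightarrow> nat \<Rightarrow> nat \<Rightarrow> bool" where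
  "P2c y z y' z' \<longleftrightarrow> y \<in> A \<and> z \<in> A \<and> y' \<in> B \<and> z' \<in> B \<and> y' \<noteq> z' \<and>
     (\<exists>x\<in>high. adj x y \<and> adj y z \<and> col (\<phi> x) y' = col y' z')"

definition P3a :: "'a \<Rightarrow> 'a \<Rightarrow> 'a \<Rightarrow> nat \<Rightarrow> nat \<Rightarrow> nat \<Rightarrow> bool" where
  "P3a y z w y' z' w' \<longleftrightarrow> {y, z, w} \<subseteq> A \<and> {y', z', w'} \<subseteq> B \<and> z \<noteq> w \<and> distinct [y', z', w'] \<and>
     adj y z \<and> adj y w \<and> col y' z' = col y' w'"

definition P3b :: "'a \<Rightarrow> 'a \<Rightarrow> 'a \<Rightarrow> nat \<Rightarrow> nat \<Rightarrow> nat \<Rightarrow> bool" where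
  "P3b y z w y' z' w' \<longleftrightarrow> {y, z, w} \<subseteq> A \<and> {y', z', w'} \<subseteq> B \<and> distinct [y, z, w] \<and> distinct [y', z', w'] \<and>
     (\<exists>x\<in>high. adj x y \<and> adj z w \<and> col (\<phi> x) y' = col z' w')"

definition P4 :: "'a \<Rightarrow> 'a \<Rightarrow> 'a \<Rightarrow> 'a \<Rightarrow> nat \<Rightarrow> nat \<Rightarrow> nat \<Rightarrow> nat \<Rightarrow> bool" where
  "P4 y z v w y' z' v' w' \<longleftrightarrow> {y, z, v, w} \<subseteq> A \<and> {y', z', v', w'} \<subseteq> B \<and>
     distinct [y, z, v, w] \<and> distinct [y', z', v', w'] \<and> adj y z \<and> adj v w \<and> col y' z' = col v' w'"

lemma P2a_sym: "P2a y z y' z' \<Longrightarrow> P2a z y z' y'"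
  unfolding P2a_def using adj_sym by (auto simp: col_sym)

lemma P2b_sym: "P2b y z y' z' \<Longrightarrow> P2b z y z' y'"
  unfolding P2b_def by metis

lemma P3a_sym: "P3a y z w y' z' w' \<Longrightarrow> P3a y w z y' w' z'"
  unfolding P3a_def by auto

lemma P3b_sym: "P3b y z w y' z' w' \<Longrightarrow> P3b y w z y' w' z'"
  unfolding P3b_def using adj_sym by (auto simp: col_sym)

lemma P4_sym: "P4 y z v w y' z' v' w' \<Longrightarrow> P4 z y v w z' y' v' w'"
  "P4 y z v w y' z' v' w' \<Longrightarrow> P4 v w y z v' w' y' z'"
  unfolding P4_def using adj_sym by (auto simp: col_sym)

section \<open>Counting the bad events at each vertex\<close>

lemmas count_intros = at_most_Sigma at_most_U at_most_high at_most_n at_most_deg at_most_arcs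
  at_most_high_nbrs class_arcs class_star at_most_high_cls

lemma E1_dom: "at_most {M \<in> E1. t \<in> fst ` M} (4 * K)"
  by (rule at_most_mono[OF at_most_image[OF at_most_bad[OF spread_\<phi> at_most_U], where f = "\<lambda>y'. {(t, y')}"]])
    (auto simp: E1_def)

lemma E1_ran: "at_most {M \<in> E1. t \<in> snd ` M} (2 * K)"
  by (rule at_most_mono[OF at_most_image[OF at_most_high_nbrs, where f = "\<lambda>(x, y). {(y, t)}"]])
    (use pow_bounds in \<open>auto simp: E1_def\<close>)

text \<open>The edge inside \<open>high\<close> enters only through its color, and
  \<open>colors U\<close> has at most \<open>R ^ 2\<close> elements. The product
  \<open>4 * R * K\<close> is then absorbed by \<open>R \<le> n\<close>.\<close>

lemma P2a_dom: "at_most {M \<in> pairs P2a. t \<in> fst ` M} (4 * K * real n)"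
proof (rule pairs_dom_sym[OF P2a_sym])
  have "at_most (SIGMA z:{z. adj t z}. \<Union>a\<in>colors U. cls a) ((2 * R ^ 2) * (R ^ 2 * (2 * k)))"
    by (intro count_intros at_most_UN at_most_colors) (use pow_bounds in auto)
  then show "at_most {(z, y', z'). P2a t z y' z'} (4 * K * real n)"
    by (rule at_most_mono) (use pow_bounds in \<open>auto simp: P2a_def power_numeral_reduce algebra_simps\<close>)
qed

lemma P2a_ran: "t \<in> B \<Longrightarrow> at_most {M \<in> pairs P2a. t \<in> snd ` M} (2 * K * real n)"
proof (rule pairs_ran_sym[OF P2a_sym])
  assume t: "t \<in> B"
  have "at_most (SIGMA (y, z):{(y, z). adj y z}. \<Union>a\<in>colors U. star t a) ((2 * real n * R) * (R ^ 2 * k))"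
    by (intro at_most_Sigma at_most_arcs) (use pow_bounds t in \<open>auto intro!: at_most_UN at_most_colors at_most_U class_star\<close>)
  then have "at_most ((\<lambda>((y, z), z'). (y, z, z')) ` (SIGMA (y, z):{(y, z). adj y z}. \<Union>a\<in>colors U. star t a)) ((2 * real n * R) * (R ^ 2 * k))"
    by (rule at_most_image)
  then show "at_most {(y, z, z'). P2a y z t z'} (2 * K * real n)"
    by (rule at_most_mono) (auto simp: P2a_def power_numeral_reduce algebra_simps image_iff)
qed

lemma P2b_dom: "at_most {M \<in> pairs P2b. t \<in> fst ` M} (4 * K * real n)"
proof (rule pairs_dom_sym[OF P2b_sym])
  \<comment> \<open>The component \<open>u\<close> is the image of the high neighbor
    \<open>x1\<close> of \<open>t\<close>. Choosing it together with \<open>y'\<close> as an arc of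
    a color class costs \<open>2 * k\<close>, without a further factor for
    \<open>x1\<close>.\<close>
  let ?S = "SIGMA (x, z):{(x, z). x \<in> high \<and> adj x z}. SIGMA z':{..<n}. cls (col (\<phi> x) z')"
  have "at_most ?S ((2 * R ^ 3) * (real n * (2 * k)))"
    by (intro at_most_Sigma at_most_high_nbrs) (use pow_bounds in \<open>auto intro!: count_intros\<close>)
  then have "at_most ((\<lambda>((x, z), z', u, y'). (z, y', z')) ` ?S) ((2 * R ^ 3) * (real n * (2 * k)))"
    by (rule at_most_image)
  then show "at_most {(z, y', z'). P2b t z y' z'} (4 * K * real n)"
  proof (rule at_most_mono)
    show "{(z, y', z'). P2b t z y' z'} \<subseteq> (\<lambda>((x, z), z', u, y'). (z, y', z')) ` ?S"
    proof clarify
      fix z y' z' assume "P2b t z y' z'"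
      then obtain x1 x2 where h: "y' \<in> B" "z' \<in> B" "x1 \<in> high" "x2 \<in> high" "adj x2 z"
        "col (\<phi> x1) y' = col (\<phi> x2) z'" unfolding P2b_def by blast
      then show "(z, y', z') \<in> (\<lambda>((x, z), z', u, y'). (z, y', z')) ` ?S"
        by (intro image_eqI[of _ _ "((x2, z), z', \<phi> x1, y')"]) (auto simp: \<phi>_less)
    qed
  qed simp
qed

text \<open>Both high vertices are paid for by \<open>at_most_high_nbrs\<close>; the resulting
  \<open>4 * R ^ 3 * K\<close> is absorbed because \<open>R ^ 3 \<le> n\<close>.\<close>

lemma P2b_ran: "t \<in> B \<Longrightarrow> at_most {M \<in> pairs P2b. t \<in> snd ` M} (4 * K * real n)"
proof (rule pairs_ran_sym[OF P2b_sym])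
  let ?S = "SIGMA (x1, y):{(x, z). x \<in> high \<and> adj x z}. SIGMA (x2, z):{(x, z). x \<in> high \<and> adj x z}.
    star (\<phi> x2) (col (\<phi> x1) t)"
  have "at_most ?S ((2 * R ^ 3) * (2 * R ^ 3 * k))"
    by (rule at_most_Sigma[OF at_most_high_nbrs], clarsimp, rule at_most_Sigma[OF at_most_high_nbrs])
      (use pow_bounds \<phi>_less in \<open>auto intro!: class_star\<close>)
  then have "at_most ((\<lambda>((x1, y), (x2, z), z'). (y, z, z')) ` ?S) ((2 * R ^ 3) * (2 * R ^ 3 * k))"
    by (rule at_most_image)
  then show "at_most {(y, z, z'). P2b y z t z'} (4 * K * real n)"
  proof (rule at_most_mono)
    show "{(y, z, z'). P2b y z t z'} \<subseteq> (\<lambda>((x1, y), (x2, z), z'). (y, z, z')) ` ?S"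
    proof clarify
      fix y z z' assume "P2b y z t z'"
      then obtain x1 x2 where h: "z' \<in> B" "x1 \<in> high" "x2 \<in> high" "adj x1 y" "adj x2 z"
        "col (\<phi> x1) t = col (\<phi> x2) z'" unfolding P2b_def by blast
      then show "(y, z, z') \<in> (\<lambda>((x1, y), (x2, z), z'). (y, z, z')) ` ?S"
        by (intro image_eqI[of _ _ "((x1, y), (x2, z), z')"]) auto
    qed
  qed (use pow_bounds in \<open>simp add: mult_ac\<close>)
qed

lemma P2c_dom: "at_most {M \<in> pairs P2c. t \<in> fst ` M} (4 * K * real n)"
proof -
  \<comment> \<open>Forgetting that \<open>x\<close> is adjacent to \<open>y\<close> lets one count
    serve for both roles of \<open>t\<close>: either way the other vertex is a neighbor of
    \<open>t\<close>.\<close>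
  let ?S = "SIGMA x:high. SIGMA z:{z. adj t z}. SIGMA y':{..<n}. star y' (col (\<phi> x) y')"
  have S: "at_most ?S (R * (2 * R ^ 2 * (real n * k)))"
    by (intro count_intros) (use pow_bounds in auto)
  have "at_most {(z, y', z'). P2c t z y' z'} (2 * K * real n)"
  proof (rule at_most_mono[OF at_most_image[OF S]])
    show "{(z, y', z'). P2c t z y' z'} \<subseteq> (\<lambda>(x, z, y', z'). (z, y', z')) ` ?S"
    proof clarify
      fix z y' z' assume "P2c t z y' z'"
      then obtain x where h: "y' \<in> B" "z' \<in> B" "y' \<noteq> z'" "x \<in> high" "adj t z"
        "col (\<phi> x) y' = col y' z'" unfolding P2c_def by blast
      then show "(z, y', z') \<in> (\<lambda>(x, z, y', z'). (z, y', z')) ` ?S"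
        by (intro image_eqI[of _ _ "(x, z, y', z')"]) auto
    qed
  qed (simp add: power_numeral_reduce mult_ac)
  moreover have "at_most {(y, y', z'). P2c y t y' z'} (2 * K * real n)"
  proof (rule at_most_mono[OF at_most_image[OF S]])
    show "{(y, y', z'). P2c y t y' z'} \<subseteq> (\<lambda>(x, y, y', z'). (y, y', z')) ` ?S"
    proof clarify
      fix y y' z' assume "P2c y t y' z'"
      then obtain x where h: "y' \<in> B" "z' \<in> B" "y' \<noteq> z'" "x \<in> high" "adj t y"
        "col (\<phi> x) y' = col y' z'" unfolding P2c_def using adj_sym by blast
      then show "(y, y', z') \<in> (\<lambda>(x, y, y', z'). (y, y', z')) ` ?S"
        by (intro image_eqI[of _ _ "(x, y, y', z')"]) auto
    qed
  qed (simp add: power_numeral_reduce mult_ac)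
  ultimately show ?thesis by (rule at_most_mono[OF pairs_dom]) auto
qed

lemma P2c_ran:
  assumes t: "t \<in> B"
  shows "at_most {M \<in> pairs P2c. t \<in> snd ` M} (8 * K * real n)"
proof -
  \<comment> \<open>Here \<open>t\<close> is the image of the middle vertex \<open>y\<close>. The
    neighbor \<open>z\<close> costs \<open>2 * R ^ 2\<close>, and the surplus factor
    \<open>R ^ 2\<close> is absorbed by \<open>n\<close>.\<close>
  let ?S = "SIGMA (x, y):{(x, y). x \<in> high \<and> adj x y}. SIGMA z:{z. adj y z}. star t (col (\<phi> x) t)"
  have S: "at_most ?S ((2 * R ^ 3) * (2 * R ^ 2 * k))"
    by (intro at_most_Sigma at_most_high_nbrs) (use pow_bounds t in \<open>auto intro!: count_intros\<close>)
  have "at_most {(y, z, z'). P2c y z t z'} (4 * K * real n)"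
  proof (rule at_most_mono[OF at_most_image[OF S]])
    show "{(y, z, z'). P2c y z t z'} \<subseteq> (\<lambda>((x, y), z, z'). (y, z, z')) ` ?S"
    proof clarify
      fix y z z' assume "P2c y z t z'"
      then obtain x where h: "z' \<in> B" "t \<noteq> z'" "x \<in> high" "adj x y" "adj y z"
        "col (\<phi> x) t = col t z'" unfolding P2c_def by blast
      then show "(y, z, z') \<in> (\<lambda>((x, y), z, z'). (y, z, z')) ` ?S"
        by (intro image_eqI[of _ _ "((x, y), z, z')"]) auto
    qed
  qed (use pow_bounds in \<open>simp add: mult_ac\<close>)
  moreover
  text \<open>Choosing \<open>x\<close> after \<open>y'\<close> leaves only \<open>k\<close> choices for it, instead of \<open>R\<close>.\<close>
  let ?T = "SIGMA y':B. SIGMA x:{x. x \<in> high \<and> col (\<phi> x) y' = col y' t}. {(y, z). adj x y \<and> adj y z}"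
  have T: "at_most ?T (real n * (k * (4 * R ^ 3)))"
    by (intro at_most_Sigma at_most_high_star at_most_paths_from at_most_mono[OF at_most_n])
      (use pow_bounds in auto)
  have "at_most {(y, z, y'). P2c y z y' t} (4 * K * real n)"
  proof (rule at_most_mono[OF at_most_image[OF T]])
    show "{(y, z, y'). P2c y z y' t} \<subseteq> (\<lambda>(y', x, y, z). (y, z, y')) ` ?T"
    proof clarify
      fix y z y' assume "P2c y z y' t"
      then obtain x where h: "y' \<in> B" "x \<in> high" "adj x y" "adj y z" "col (\<phi> x) y' = col y' t"
        unfolding P2c_def by blast
      then show "(y, z, y') \<in> (\<lambda>(y', x, y, z). (y, z, y')) ` ?T"
        by (intro image_eqI[of _ _ "(y', x, y, z)"]) auto
    qed
  qed (simp add: mult_ac)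
  ultimately show ?thesis by (rule at_most_mono[OF pairs_ran]) auto
qed

text \<open>Here it matters that the vertices are low: as a center \<open>t\<close> has at most
  \<open>2 * R ^ 3\<close> ordered pairs of neighbors, and as a leaf it starts at most
  \<open>2 * R ^ 3\<close> paths with a low center. Two of the images are free, and the third lies
  in a star of one color at \<open>y'\<close>.\<close>

lemma P3a_dom:
  assumes t: "t \<in> A"
  shows "at_most {M \<in> triples P3a. t \<in> fst ` M} (4 * K * real n ^ 2)"
proof -
  let ?C = "SIGMA y':{..<n}. SIGMA z':{..<n}. star y' (col y' z')"
  have C: "at_most ?C (real n * (real n * k))" by (intro count_intros) (use pow_bounds in auto)
  have S: "at_most ({(z, w). adj t z \<and> adj t w \<and> z \<noteq> w} \<times> ?C) ((2 * R ^ 3) * (real n * (real n * k)))"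
    by (intro at_most_Sigma C at_most_mono[OF at_most_nbr_pairs subset_refl deg_low[OF t]])
      (use pow_bounds in auto)
  have "at_most {(z, w, y', z', w'). P3a t z w y' z' w'} (2 * K * real n ^ 2)"
  proof (rule at_most_mono[OF at_most_image[OF S]])
    show "{(z, w, y', z', w'). P3a t z w y' z' w'}
        \<subseteq> (\<lambda>((z, w), y', z', w'). (z, w, y', z', w')) ` ({(z, w). adj t z \<and> adj t w \<and> z \<noteq> w} \<times> ?C)"
    proof clarify
      fix z w y' z' w' assume "P3a t z w y' z' w'"
      then show "(z, w, y', z', w') \<in> (\<lambda>((z, w), y', z', w'). (z, w, y', z', w')) ` ({(z, w). adj t z \<and> adj t w \<and> z \<noteq> w} \<times> ?C)"
        unfolding P3a_def by (intro image_eqI[of _ _ "((z, w), y', z', w')"]) auto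
    qed
  qed (simp add: power2_eq_square mult_ac)
  moreover
  have T: "at_most ({(y, w). y \<in> A \<and> adj t y \<and> adj y w \<and> w \<noteq> t} \<times> ?C) ((2 * R ^ 3) * (real n * (real n * k)))"
    by (intro at_most_Sigma C at_most_low_paths_from t) (use pow_bounds in auto)
  have "at_most {(y, w, y', z', w'). P3a y t w y' z' w'} (2 * K * real n ^ 2)"
  proof (rule at_most_mono[OF at_most_image[OF T]])
    show "{(y, w, y', z', w'). P3a y t w y' z' w'}
        \<subseteq> (\<lambda>((z, w), y', z', w'). (z, w, y', z', w')) ` ({(y, w). y \<in> A \<and> adj t y \<and> adj y w \<and> w \<noteq> t} \<times> ?C)"
    proof clarify
      fix y w y' z' w' assume "P3a y t w y' z' w'"
      then show "(y, w, y', z', w') \<in> (\<lambda>((z, w), y', z', w'). (z, w, y', z', w')) ` ({(y, w). y \<in> A \<and> adj t y \<and> adj y w \<and> w \<noteq> t} \<times> ?C)"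
        unfolding P3a_def using adj_sym by (intro image_eqI[of _ _ "((y, w), y', z', w')"]) auto
    qed
  qed (simp add: power2_eq_square mult_ac)
  ultimately show ?thesis by (rule at_most_mono[OF triples_dom_sym[OF P3a_sym, rotated]]) auto
qed

text \<open>With an image fixed instead of a vertex, only the total number of cherries is available.
  One factor \<open>R\<close> of \<open>2 * R ^ 4\<close> is traded for a factor
  \<open>n\<close>.\<close>

lemma P3a_ran:
  assumes t: "t \<in> B"
  shows "at_most {M \<in> triples P3a. t \<in> snd ` M} (4 * K * real n ^ 2)"
proof -
  let ?H = "{(y, z, w). adj y z \<and> adj z w \<and> y \<noteq> w}"
  have arith: "2 * R ^ 4 * (real n * k) \<le> 2 * K * real n ^ 2"
    using mult_left_mono[OF pow_bounds(1), of "2 * real n"] by (simp add: power_numeral_reduce mult_ac)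
  have S: "at_most (?H \<times> (SIGMA z':{..<n}. star t (col t z'))) (2 * R ^ 4 * (real n * k))"
    by (intro at_most_Sigma few at_most_n class_star) (use pow_bounds t in auto)
  have "at_most {(y, z, w, z', w'). P3a y z w t z' w'} (2 * K * real n ^ 2)"
  proof (rule at_most_mono[OF at_most_image[OF S]])
    show "{(y, z, w, z', w'). P3a y z w t z' w'}
        \<subseteq> (\<lambda>((z, y, w), z', w'). (y, z, w, z', w')) ` (?H \<times> (SIGMA z':{..<n}. star t (col t z')))"
    proof clarify
      fix y z w z' w' assume "P3a y z w t z' w'"
      then show "(y, z, w, z', w') \<in> (\<lambda>((z, y, w), z', w'). (y, z, w, z', w')) ` (?H \<times> (SIGMA z':{..<n}. star t (col t z')))"
        unfolding P3a_def using adj_sym by (intro image_eqI[of _ _ "((z, y, w), z', w')"]) auto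
    qed
  qed (use arith in simp)
  moreover
  have T: "at_most (?H \<times> (SIGMA y':{..<n}. star y' (col y' t))) (2 * R ^ 4 * (real n * k))"
    by (intro at_most_Sigma few at_most_n class_star) (use pow_bounds t in auto)
  have "at_most {(y, z, w, y', w'). P3a y z w y' t w'} (2 * K * real n ^ 2)"
  proof (rule at_most_mono[OF at_most_image[OF T]])
    show "{(y, z, w, y', w'). P3a y z w y' t w'}
        \<subseteq> (\<lambda>((z, y, w), y', w'). (y, z, w, y', w')) ` (?H \<times> (SIGMA y':{..<n}. star y' (col y' t)))"
    proof clarify
      fix y z w y' w' assume "P3a y z w y' t w'"
      then show "(y, z, w, y', w') \<in> (\<lambda>((z, y, w), y', w'). (y, z, w, y', w')) ` (?H \<times> (SIGMA y':{..<n}. star y' (col y' t)))"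
        unfolding P3a_def using adj_sym by (intro image_eqI[of _ _ "((z, y, w), y', w')"]) auto
    qed
  qed (use arith in simp)
  ultimately show ?thesis by (rule at_most_mono[OF triples_ran_sym[OF P3a_sym, rotated]]) auto
qed

text \<open>Either \<open>t\<close> is the neighbor of \<open>x\<close> and the other edge is
  arbitrary, or \<open>t\<close> lies on the other edge, whose second end then has at most
  \<open>2 * R ^ 2\<close> choices. In both cases the color class supplies the images of the other
  edge.\<close>

lemma P3b_dom: "at_most {M \<in> triples P3b. t \<in> fst ` M} (12 * K * real n ^ 2)"
proof -
  let ?S = "SIGMA x:high. {(z, w). adj z w} \<times> (SIGMA y':{..<n}. cls (col (\<phi> x) y'))"
  have S: "at_most ?S (R * (2 * real n * R * (real n * (2 * k))))"
    by (intro count_intros) (use pow_bounds in auto)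
  have "at_most {(z, w, y', z', w'). P3b t z w y' z' w'} (4 * K * real n ^ 2)"
  proof (rule at_most_mono[OF at_most_image[OF S]])
    show "{(z, w, y', z', w'). P3b t z w y' z' w'} \<subseteq> (\<lambda>(x, (z, w), y', z', w'). (z, w, y', z', w')) ` ?S"
    proof clarify
      fix z w y' z' w' assume P: "P3b t z w y' z' w'"
      then obtain x where "x \<in> high" "adj z w" "col (\<phi> x) y' = col z' w'" unfolding P3b_def by blast
      then show "(z, w, y', z', w') \<in> (\<lambda>(x, (z, w), y', z', w'). (z, w, y', z', w')) ` ?S"
        using P unfolding P3b_def by (intro image_eqI[of _ _ "(x, (z, w), y', z', w')"]) auto
    qed
    have "R ^ 2 * k \<le> R ^ 3 * k" using R pow_bounds by (intro mult_right_mono power_increasing) auto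
    then show "R * (2 * real n * R * (real n * (2 * k))) \<le> 4 * K * real n ^ 2"
      using mult_left_mono[of "R ^ 2 * k" "R ^ 3 * k" "4 * real n ^ 2"] by (simp add: power2_eq_square mult_ac)
  qed
  moreover
  let ?T = "SIGMA (x, y):{(x, y). x \<in> high \<and> adj x y}. {w. adj t w} \<times> (SIGMA y':{..<n}. cls (col (\<phi> x) y'))"
  have T: "at_most ?T (2 * R ^ 3 * (2 * R ^ 2 * (real n * (2 * k))))"
    by (intro at_most_Sigma_pair count_intros) (use pow_bounds in auto)
  have "at_most {(y, w, y', z', w'). P3b y t w y' z' w'} (8 * K * real n ^ 2)"
  proof (rule at_most_mono[OF at_most_image[OF T]])
    show "{(y, w, y', z', w'). P3b y t w y' z' w'} \<subseteq> (\<lambda>((x, y), w, y', z', w'). (y, w, y', z', w')) ` ?T"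
    proof clarify
      fix y w y' z' w' assume P: "P3b y t w y' z' w'"
      then obtain x where "x \<in> high" "adj x y" "adj t w" "col (\<phi> x) y' = col z' w'" unfolding P3b_def by blast
      then show "(y, w, y', z', w') \<in> (\<lambda>((x, y), w, y', z', w'). (y, w, y', z', w')) ` ?T"
        using P unfolding P3b_def by (intro image_eqI[of _ _ "((x, y), w, y', z', w')"]) auto
    qed
    show "2 * R ^ 3 * (2 * R ^ 2 * (real n * (2 * k))) \<le> 8 * K * real n ^ 2"
      using mult_left_mono[OF pow_bounds(2), of "8 * real n"] by (simp add: power2_eq_square mult_ac)
  qed
  ultimately show ?thesis by (rule at_most_mono[OF triples_dom_sym[OF P3b_sym, rotated]]) auto
qed

lemma P3b_ran: "at_most {M \<in> triples P3b. t \<in> snd ` M} (16 * K * real n ^ 2)"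
proof -
  let ?S = "SIGMA (x, y):{(x, y). x \<in> high \<and> adj x y}. {(z, w). adj z w} \<times> cls (col (\<phi> x) t)"
  have S: "at_most ?S (2 * R ^ 3 * (2 * real n * R * (2 * k)))"
    by (intro at_most_Sigma_pair count_intros) (use pow_bounds in auto)
  have "at_most {(y, z, w, z', w'). P3b y z w t z' w'} (8 * K * real n ^ 2)"
  proof (rule at_most_mono[OF at_most_image[OF S]])
    show "{(y, z, w, z', w'). P3b y z w t z' w'} \<subseteq> (\<lambda>((x, y), (z, w), z', w'). (y, z, w, z', w')) ` ?S"
    proof clarify
      fix y z w z' w' assume P: "P3b y z w t z' w'"
      then obtain x where "x \<in> high" "adj x y" "adj z w" "col (\<phi> x) t = col z' w'" unfolding P3b_def by blast
      then show "(y, z, w, z', w') \<in> (\<lambda>((x, y), (z, w), z', w'). (y, z, w, z', w')) ` ?S"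
        using P unfolding P3b_def by (intro image_eqI[of _ _ "((x, y), (z, w), z', w')"]) auto
    qed
    show "2 * R ^ 3 * (2 * real n * R * (2 * k)) \<le> 8 * K * real n ^ 2"
      using mult_left_mono[OF pow_bounds(1), of "8 * real n"] by (simp add: power2_eq_square mult_ac)
  qed
  moreover
  text \<open>Choosing \<open>x\<close> together with \<open>y'\<close> inside one color class saves the sum over \<open>high\<close>.\<close>
  let ?T = "SIGMA w':{..<n}. SIGMA (x, y'):{(x, y'). x \<in> high \<and> y' \<notin> U \<and> y' < n \<and> col (\<phi> x) y' = col t w'}.
    {y. adj x y} \<times> {(z, w). adj z w}"
  have T: "at_most ?T (real n * (2 * k * (2 * R ^ 2 * (2 * real n * R))))"
    by (intro at_most_Sigma_pair count_intros) (use pow_bounds in auto)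
  have "at_most {(y, z, w, y', w'). P3b y z w y' t w'} (8 * K * real n ^ 2)"
  proof (rule at_most_mono[OF at_most_image[OF T]])
    show "{(y, z, w, y', w'). P3b y z w y' t w'} \<subseteq> (\<lambda>(w', (x, y'), y, (z, w)). (y, z, w, y', w')) ` ?T"
    proof clarify
      fix y z w y' w' assume P: "P3b y z w y' t w'"
      then obtain x where "x \<in> high" "adj x y" "adj z w" "col (\<phi> x) y' = col t w'" unfolding P3b_def by blast
      then show "(y, z, w, y', w') \<in> (\<lambda>(w', (x, y'), y, (z, w)). (y, z, w, y', w')) ` ?T"
        using P unfolding P3b_def by (intro image_eqI[of _ _ "(w', (x, y'), y, (z, w))"]) auto
    qed
  qed (simp add: power_numeral_reduce mult_ac)
  ultimately show ?thesis by (rule at_most_mono[OF triples_ran_sym[OF P3b_sym, rotated]]) auto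
qed

text \<open>A neighbor of \<open>t\<close>, an arbitrary arc, two free images and an arc of a color
  class. The product is exactly the stated bound, with no slack in the power of
  \<open>R\<close>.\<close>

lemma P4_dom: "at_most {M \<in> quads P4. t \<in> fst ` M} (8 * K * real n ^ 3)"
proof (rule quads_dom_sym[OF P4_sym])
  let ?S = "{z. adj t z} \<times> {(v, w). adj v w} \<times> (SIGMA y':{..<n}. SIGMA z':{..<n}. cls (col y' z'))"
  have S: "at_most ?S (2 * R ^ 2 * (2 * real n * R * (real n * (real n * (2 * k)))))"
    by (intro count_intros) (use pow_bounds in auto)
  show "at_most {(z, v, w, y', z', v', w'). P4 t z v w y' z' v' w'} (8 * K * real n ^ 3)"
  proof (rule at_most_mono[OF at_most_image[OF S]])
    show "{(z, v, w, y', z', v', w'). P4 t z v w y' z' v' w'}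
        \<subseteq> (\<lambda>(z, (v, w), y', z', v', w'). (z, v, w, y', z', v', w')) ` ?S"
    proof clarify
      fix z v w y' z' v' w' assume P: "P4 t z v w y' z' v' w'"
      then show "(z, v, w, y', z', v', w') \<in> (\<lambda>(z, (v, w), y', z', v', w'). (z, v, w, y', z', v', w')) ` ?S"
        unfolding P4_def by (intro image_eqI[of _ _ "(z, (v, w), y', z', v', w')"]) auto
    qed
  qed (simp add: power_numeral_reduce mult_ac)
qed

lemma P4_ran: "at_most {M \<in> quads P4. t \<in> snd ` M} (8 * K * real n ^ 3)"
proof (rule quads_ran_sym[OF P4_sym])
  let ?S = "{(y, z). adj y z} \<times> {(v, w). adj v w} \<times> (SIGMA z':{..<n}. cls (col t z'))"
  have S: "at_most ?S (2 * real n * R * (2 * real n * R * (real n * (2 * k))))"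
    by (intro count_intros) (use pow_bounds in auto)
  show "at_most {(y, z, v, w, z', v', w'). P4 y z v w t z' v' w'} (8 * K * real n ^ 3)"
  proof (rule at_most_mono[OF at_most_image[OF S]])
    show "{(y, z, v, w, z', v', w'). P4 y z v w t z' v' w'}
        \<subseteq> (\<lambda>((y, z), (v, w), z', v', w'). (y, z, v, w, z', v', w')) ` ?S"
    proof clarify
      fix y z v w z' v' w' assume P: "P4 y z v w t z' v' w'"
      then show "(y, z, v, w, z', v', w') \<in> (\<lambda>((y, z), (v, w), z', v', w'). (y, z, v, w, z', v', w')) ` ?S"
        unfolding P4_def by (intro image_eqI[of _ _ "((y, z), (v, w), z', v', w')"]) auto
    qed
    have "R ^ 2 * k \<le> R ^ 3 * k" using R pow_bounds by (intro mult_right_mono power_increasing) auto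
    then show "2 * real n * R * (2 * real n * R * (real n * (2 * k))) \<le> 8 * K * real n ^ 3"
      using mult_left_mono[of "R ^ 2 * k" "R ^ 3 * k" "8 * real n ^ 3"] by (simp add: power_numeral_reduce mult_ac)
  qed
qed

section \<open>The local lemma for all bad events together\<close>

definition family :: "nat \<Rightarrow> ('a \<times> nat) set set" where
  "family j = (if j = 1 then E1 else if j = 2 then pairs P2a \<union> pairs P2b \<union> pairs P2c
     else if j = 3 then triples P3a \<union> triples P3b else quads P4)"

definition dom_bound :: "nat \<Rightarrow> real" where
  "dom_bound j = (if j = 1 then 4 else if j = 2 then 12 else if j = 3 then 16 else 8)"

definition ran_bound :: "nat \<Rightarrow> real" where
  "ran_bound j = (if j = 1 then 2 else if j = 2 then 14 else if j = 3 then 20 else 8)"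

lemma upto_4: "j \<in> {1..4::nat} \<longleftrightarrow> j = 1 \<or> j = 2 \<or> j = 3 \<or> j = 4"
  by auto

lemma family_matching:
  assumes "j \<in> {1..4}" "M \<in> family j"
  shows "M \<subseteq> A \<times> B \<and> card M = j"
proof -
  have m1: "M \<subseteq> A \<times> B \<and> card M = 1" if "M \<in> E1"
    using that unfolding E1_def bad_def by auto
  have m2: "M \<subseteq> A \<times> B \<and> card M = 2" if "M \<in> pairs P2a \<union> pairs P2b \<union> pairs P2c"
    using that adj_irrefl unfolding pairs_def P2a_def P2b_def P2c_def by (auto simp: card_insert_if)
  have m3: "M \<subseteq> A \<times> B \<and> card M = 3" if "M \<in> triples P3a \<union> triples P3b"
    using that adj_irrefl unfolding triples_def P3a_def P3b_def by (auto simp: card_insert_if)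
  have m4: "M \<subseteq> A \<times> B \<and> card M = 4" if "M \<in> quads P4"
    using that unfolding quads_def P4_def by (auto simp: card_insert_if)
  from assms consider "j = 1" "M \<in> E1" | "j = 2" "M \<in> pairs P2a \<union> pairs P2b \<union> pairs P2c"
    | "j = 3" "M \<in> triples P3a \<union> triples P3b" | "j = 4" "M \<in> quads P4"
    unfolding family_def upto_4 by (auto split: if_splits)
  then show ?thesis using m1 m2 m3 m4 by cases blast+
qed

lemma family_dom:
  assumes "j \<in> {1..4}" "t \<in> A"
  shows "at_most {M \<in> family j. t \<in> fst ` M} (dom_bound j * K * real n ^ (j - 1))"
proof -
  have 2: "at_most {M \<in> pairs P2a \<union> pairs P2b \<union> pairs P2c. t \<in> fst ` M} (12 * K * real n)"
    by (rule at_most_mono[OF at_most_Un[OF at_most_Un[OF P2a_dom P2b_dom] P2c_dom]]) auto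
  have 3: "at_most {M \<in> triples P3a \<union> triples P3b. t \<in> fst ` M} (16 * K * real n ^ 2)"
    by (rule at_most_mono[OF at_most_Un[OF P3a_dom[OF assms(2)] P3b_dom]]) auto
  show ?thesis using assms(1) E1_dom[of t] 2 3 P4_dom[of t]
    unfolding family_def dom_bound_def upto_4 by auto
qed

lemma family_ran:
  assumes "j \<in> {1..4}" "t \<in> B"
  shows "at_most {M \<in> family j. t \<in> snd ` M} (ran_bound j * K * real n ^ (j - 1))"
proof -
  have 2: "at_most {M \<in> pairs P2a \<union> pairs P2b \<union> pairs P2c. t \<in> snd ` M} (14 * K * real n)"
    by (rule at_most_mono[OF at_most_Un[OF at_most_Un[OF P2a_ran P2b_ran] P2c_ran]]) (use assms in auto)
  have 3: "at_most {M \<in> triples P3a \<union> triples P3b. t \<in> snd ` M} (20 * K * real n ^ 2)"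
    by (rule at_most_mono[OF at_most_Un[OF P3a_ran[OF assms(2)] P3b_ran]]) auto
  show ?thesis using assms(1) E1_ran[of t] 2 3 P4_ran[of t]
    unfolding family_def ran_bound_def upto_4 by auto
qed

lemma card_A: "card A = card B" "real n - R \<le> real (card A)"
proof -
  have U: "U \<subseteq> {..<n}" using \<phi>_less by auto
  have "card A = n - card high" using cardV finV high_V by (simp add: card_Diff_subset finite_high)
  moreover have "card B = n - card high" using U inj_\<phi>
    by (simp add: card_Diff_subset finite_high card_image)
  ultimately show "card A = card B" by simp
  have "card high \<le> n" using card_mono[OF finV high_V] cardV by simp
  then have "real (card A) = real n - real (card high)" using \<open>card A = n - card high\<close> by simp
  then show "real n - R \<le> real (card A)" using at_most_high unfolding at_most_def by simp
qed

lemma avoiding_bijection: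
  "\<exists>\<pi>. bij_betw \<pi> A B \<and> (\<forall>j\<in>{1..4}. \<forall>M\<in>family j. \<not> extends \<pi> M)"
proof (rule vertexwise_local_lemma[OF _ _ card_A(1) _ _ family_matching family_dom family_ran refl])
  define q where "q = 1 / (real (card A) - real 4 + 1)"
  have R3: "R \<le> R ^ 3" using power_increasing[of 1 3 R] R by simp
  have big: "1512 * R \<le> real n" "1512 \<le> real n" using n_R R R3 by linarith+
  \<comment> \<open>Both \<open>R\<close> and 1 are at most \<open>n / 1512\<close>, so the loss
    \<open>R + 3\<close> is at most \<open>4 * n / 1512\<close>.\<close>
  have Agt: "1508 / 1512 * real n \<le> real (card A) - real 4 + 1" using card_A(2) big R by simp
  then have "4 \<le> real (card A)" using big by simp
  then show "4 \<le> card A" by simp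
  have n0: "real n > 0" using big by linarith
  have q0: "0 \<le> q" unfolding q_def using \<open>4 \<le> real (card A)\<close> by simp
  have qn: "q * real n \<le> 1512 / 1508"
    unfolding q_def using Agt n0 by (simp add: field_simps)
  have qK: "q * K \<le> 1 / 1508"
  proof -
    have "q * (1512 * K) \<le> q * real n" using kRn q0 by (intro mult_left_mono) (auto simp: mult_ac)
    then show ?thesis using qn by simp
  qed
  \<comment> \<open>\<open>q\<close> exceeds \<open>1 / n\<close> by a factor of at most
    \<open>1512 / 1508\<close>; the constant 1490 absorbs the powers of this factor for all four
    sizes.\<close>
  have summand: "c * K * real n ^ (j - 1) * q ^ j \<le> c * (1 / 1490)" if "0 \<le> c" "j \<in> {1..4}" for c j
  proof -
    have "c * K * real n ^ (j - 1) * q ^ j = c * ((q * K) * (q * real n) ^ (j - 1))"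
      using that(2) by (cases j) (auto simp: power_mult_distrib)
    also have "\<dots> \<le> c * ((1 / 1508) * (1512 / 1508) ^ 3)"
    proof -
      have "(q * real n) ^ (j - 1) \<le> (1512 / 1508) ^ (j - 1)" using qn q0 by (intro power_mono) auto
      also have "\<dots> \<le> (1512 / 1508) ^ 3" using that(2) by (intro power_increasing) auto
      finally show ?thesis using qK q0 pow_bounds that(1) by (intro mult_left_mono mult_mono) auto
    qed
    also have "\<dots> \<le> c * (1 / 1490)" using that(1) by (intro mult_left_mono) (auto simp: power_numeral_reduce)
    finally show ?thesis .
  qed
  have "(\<Sum>j = 1..4. (dom_bound j * K * real n ^ (j - 1) + ran_bound j * K * real n ^ (j - 1)) * q ^ j)
      \<le> (\<Sum>j = 1..4. (dom_bound j + ran_bound j) * (1 / 1490))"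
  proof (rule sum_mono)
    fix j :: nat assume j: "j \<in> {1..4}"
    have "0 \<le> dom_bound j + ran_bound j" unfolding dom_bound_def ran_bound_def by auto
    from summand[OF this j] show "(dom_bound j * K * real n ^ (j - 1) + ran_bound j * K * real n ^ (j - 1)) * q ^ j
        \<le> (dom_bound j + ran_bound j) * (1 / 1490)" by (simp add: algebra_simps)
  qed
  \<comment> \<open>The constants add up to 40 at a vertex of the graph and to 44 at a vertex of
    \<open>K\<^sub>n\<close>; \<open>84 / 1490\<close> lies below the required
    \<open>1 / 16\<close>.\<close>
  also have "\<dots> = 84 / 1490"
    unfolding dom_bound_def ran_bound_def by (simp add: numeral_eq_Suc sum.atLeast_Suc_atMost)
  finally show "(\<Sum>j = 1..4. (dom_bound j * K * real n ^ (j - 1) + ran_bound j * K * real n ^ (j - 1)) *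
      (1 / (real (card A) - real 4 + 1)) ^ j) \<le> 1 / (4 * real 4)"
    unfolding q_def by simp
qed (use finV in auto)

end

subsection \<open>The rainbow embedding\<close>

context partial_embedding begin

text \<open>Two distinct edges share one vertex or none. Sorted by which ends are high, a repeated
  color is either excluded by \<open>spread\<close> or would be a bad event extended by
  \<open>\<pi>\<close>.\<close>

lemma rainbow_extension:
  "\<exists>g. bij_betw g V {..<n} \<and>
     (\<forall>a b p q. adj a b \<and> adj p q \<and> {a, b} \<noteq> {p, q} \<longrightarrow> col (g a) (g b) \<noteq> col (g p) (g q))"
proof -
  obtain \<pi> where \<pi>: "bij_betw \<pi> A B" and av: "\<And>j M. j \<in> {1..4} \<Longrightarrow> M \<in> family j \<Longrightarrow> \<not> extends \<pi> M"
    using avoiding_bijection by blast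
  define g where "g = (\<lambda>x. if x \<in> high then \<phi> x else \<pi> x)"
  have gh: "g x = \<phi> x" if "x \<in> high" for x using that unfolding g_def by simp
  have gA: "g x = \<pi> x" if "x \<in> A" for x using that unfolding g_def by simp
  have gB: "g x \<in> B" if "x \<in> A" for x using that \<pi> gA bij_betwE by fastforce
  have "bij_betw g high U" using inj_\<phi> gh by (auto simp: bij_betw_def inj_on_def)
  moreover have "bij_betw g A B" using \<pi> bij_betw_cong[of A g \<pi> B] gA by blast
  ultimately have "bij_betw g (high \<union> A) (U \<union> B)" by (rule bij_betw_combine) auto
  moreover have "high \<union> A = V" "U \<union> B = {..<n}" using high_V \<phi>_less by auto
  ultimately have bij: "bij_betw g V {..<n}" by simp
  have ginj: "g x \<noteq> g y" if "x \<in> V" "y \<in> V" "x \<noteq> y" for x y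
    using bij that unfolding bij_betw_def inj_on_def by blast
  have gU: "g x \<in> U" if "x \<in> high" for x using gh that by simp
  have AV: "x \<in> V" if "x \<in> A" for x using that by simp
  have HV: "x \<in> V" if "x \<in> high" for x using that high_V by auto
  have ext: "extends \<pi> M" if "M \<subseteq> (\<lambda>x. (x, g x)) ` A" for M
    using that gA unfolding extends_def by auto
  have h1: "g y \<notin> bad U" if "y \<in> A" "x \<in> high" "adj x y" for x y
  proof
    assume "g y \<in> bad U"
    then have "{(y, g y)} \<in> family 1" using that unfolding family_def E1_def by auto
    then show False using av[of 1 "{(y, g y)}"] ext[of "{(y, g y)}"] that by auto
  qed
  have pairs: "\<not> P y z (g y) (g z)" if "pairs P \<subseteq> family 2" "y \<in> A" "z \<in> A" for P y z
  proof
    assume "P y z (g y) (g z)"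
    then have "{(y, g y), (z, g z)} \<in> family 2" using that(1) unfolding pairs_def by blast
    then show False using av[of 2 "{(y, g y), (z, g z)}"] ext[of "{(y, g y), (z, g z)}"] that by auto
  qed
  have triples: "\<not> P y z w (g y) (g z) (g w)" if "triples P \<subseteq> family 3" "y \<in> A" "z \<in> A" "w \<in> A" for P y z w
  proof
    assume "P y z w (g y) (g z) (g w)"
    then have "{(y, g y), (z, g z), (w, g w)} \<in> family 3" using that(1) unfolding triples_def by blast
    then show False using av[of 3 "{(y, g y), (z, g z), (w, g w)}"] ext[of "{(y, g y), (z, g z), (w, g w)}"] that by auto
  qed
  have h2a: "col (g y) (g z) \<notin> colors U" if "y \<in> A" "z \<in> A" "adj y z" for y z
  proof -
    have "y \<noteq> z" using that adj_irrefl by auto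
    then show ?thesis using pairs[of P2a y z] gB ginj that unfolding family_def P2a_def by auto
  qed
  have h2b: "col (g x1) (g y) \<noteq> col (g x2) (g z)"
    if "y \<in> A" "z \<in> A" "y \<noteq> z" "x1 \<in> high" "x2 \<in> high" "adj x1 y" "adj x2 z" for x1 x2 y z
  proof -
    have "\<not> P2b y z (g y) (g z)" by (rule pairs) (use that in \<open>auto simp: family_def\<close>)
    then show ?thesis using gB[OF that(1)] gB[OF that(2)] ginj[OF AV[OF that(1)] AV[OF that(2)] that(3)] that
      unfolding P2b_def gh[OF that(4)] gh[OF that(5)] by blast
  qed
  have h2c: "col (g x) (g y) \<noteq> col (g y) (g z)"
    if "y \<in> A" "z \<in> A" "x \<in> high" "adj x y" "adj y z" for x y z
  proof -
    have yz: "y \<noteq> z" using that adj_irrefl by auto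
    have "\<not> P2c y z (g y) (g z)" by (rule pairs) (use that in \<open>auto simp: family_def\<close>)
    then show ?thesis using gB[OF that(1)] gB[OF that(2)] ginj[OF AV[OF that(1)] AV[OF that(2)] yz] that
      unfolding P2c_def gh[OF that(3)] by blast
  qed
  have h3a: "col (g y) (g z) \<noteq> col (g y) (g w)"
    if "y \<in> A" "z \<in> A" "w \<in> A" "z \<noteq> w" "adj y z" "adj y w" for y z w
  proof -
    have yz: "y \<noteq> z" "y \<noteq> w" using that adj_irrefl by auto
    have "\<not> P3a y z w (g y) (g z) (g w)" by (rule triples) (use that in \<open>auto simp: family_def\<close>)
    moreover have "distinct [g y, g z, g w]" using ginj AV that yz by auto
    ultimately show ?thesis using that gB[OF that(1)] gB[OF that(2)] gB[OF that(3)]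
      unfolding P3a_def by simp
  qed
  have h3b: "col (g x) (g y) \<noteq> col (g z) (g w)"
    if "y \<in> A" "z \<in> A" "w \<in> A" "x \<in> high" "distinct [y, z, w]" "adj x y" "adj z w" for x y z w
  proof -
    have "\<not> P3b y z w (g y) (g z) (g w)" by (rule triples) (use that in \<open>auto simp: family_def\<close>)
    moreover have "distinct [g y, g z, g w]" using ginj AV that by auto
    ultimately show ?thesis using that gB[OF that(1)] gB[OF that(2)] gB[OF that(3)]
      unfolding P3b_def gh[OF that(4)] by auto
  qed
  have h4: "col (g y) (g z) \<noteq> col (g v) (g w)"
    if "y \<in> A" "z \<in> A" "v \<in> A" "w \<in> A" "distinct [y, z, v, w]" "adj y z" "adj v w" for y z v w
  proof
    assume c: "col (g y) (g z) = col (g v) (g w)"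
    have "distinct [g y, g z, g v, g w]" using ginj AV that by auto
    then have "P4 y z v w (g y) (g z) (g v) (g w)" using that gB[OF that(1)] gB[OF that(2)] gB[OF that(3)] gB[OF that(4)] c
      unfolding P4_def by simp
    then have "{(y, g y), (z, g z), (v, g v), (w, g w)} \<in> quads P4" unfolding quads_def by blast
    then have "{(y, g y), (z, g z), (v, g v), (w, g w)} \<in> family 4" unfolding family_def by simp
    then show False using av[of 4 "{(y, g y), (z, g z), (v, g v), (w, g w)}"] ext[of "{(y, g y), (z, g z), (v, g v), (w, g w)}"] that by auto
  qed
  have cU: "col (g a) (g b) \<in> colors U" if "a \<in> high" "b \<in> high" "a \<noteq> b" for a b
    using gU[OF that(1)] gU[OF that(2)] ginj[OF HV[OF that(1)] HV[OF that(2)] that(3)]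
    unfolding colors_def by blast
  \<comment> \<open>\<open>bad1\<close> and \<open>bad2\<close> are the negations of the two clauses
    in \<open>bad\<close>; both follow from avoiding \<open>E1\<close>.\<close>
  have bad1: "col (g x) (g y) \<notin> colors U" if "y \<in> A" "x \<in> high" "adj x y" for x y
    using h1[OF that] gB[OF that(1)] gU[OF that(2)] unfolding bad_def by blast
  have bad2: "col (g x) (g y) \<noteq> col (g x') (g y)" if "y \<in> A" "x \<in> high" "x' \<in> high" "x \<noteq> x'" "adj x y" for x x' y
  proof -
    have "g x \<noteq> g x'" using ginj[OF HV[OF that(2)] HV[OF that(3)] that(4)] .
    then show ?thesis using h1[OF that(1,2,5)] gB[OF that(1)] gU[OF that(2)] gU[OF that(3)]
      unfolding bad_def by blast
  qed
  have hh: "col (g a) (g b) \<noteq> col (g p) (g q)"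
    if "a \<in> high" "b \<in> high" "p \<in> high" "q \<in> high" "a \<noteq> b" "p \<noteq> q" "{a, b} \<noteq> {p, q}" for a b p q
  proof -
    have giff: "g x = g y \<longleftrightarrow> x = y" if "x \<in> high" "y \<in> high" for x y
      using ginj[OF HV[OF that(1)] HV[OF that(2)]] by blast
    have "g a \<noteq> g b" "g p \<noteq> g q" "{g a, g b} \<noteq> {g p, g q}"
      using that by (auto simp: doubleton_eq_iff giff)
    then show ?thesis
      by (rule spread_rainbow[OF spread_\<phi> gU[OF that(1)] gU[OF that(2)] gU[OF that(3)] gU[OF that(4)]])
  qed
  have cherry: "col (g a) (g b) \<noteq> col (g a) (g q)" if "adj a b" "adj a q" "b \<noteq> q" for a b q
  proof -
    have ne: "a \<noteq> b" "a \<noteq> q" using that adj_irrefl by auto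
    have s: "adj b a" "adj q a" using that adj_sym by auto
    have V: "a \<in> V" "b \<in> V" "q \<in> V" using that adj_V adj_V2 by auto
    \<comment> \<open>Three high vertices are handled by \<open>spread\<close>. Two high vertices
      lead to \<open>E1\<close>, one leads to \<open>P2b\<close> or \<open>P2c\<close> according to
      whether the center is high, and none leads to \<open>P3a\<close>.\<close>
    consider "a \<in> high" "b \<in> high" "q \<in> high" | "a \<in> high" "b \<in> high" "q \<in> A" | "a \<in> high" "b \<in> A" "q \<in> high"
      | "a \<in> high" "b \<in> A" "q \<in> A" | "a \<in> A" "b \<in> high" "q \<in> high" | "a \<in> A" "b \<in> high" "q \<in> A"
      | "a \<in> A" "b \<in> A" "q \<in> high" | "a \<in> A" "b \<in> A" "q \<in> A" using V by blast
    then show ?thesis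
    proof cases
      case 1
      then show ?thesis using hh[of a b a q] ne that by (auto simp: doubleton_eq_iff)
    next
      case 2
      then show ?thesis using cU[of a b] bad1[of q a] ne that by metis
    next
      case 3
      then show ?thesis using cU[of a q] bad1[of b a] ne that by metis
    next
      case 4
      then show ?thesis using h2b[of b q a a] that by blast
    next
      case 5
      then show ?thesis using bad2[of a b q] s that by (metis col_sym)
    next
      case 6
      then show ?thesis using h2c[of a q b] s that by (metis col_sym)
    next
      case 7
      then show ?thesis using h2c[of a b q] s that by (metis col_sym)
    next
      case 8
      then show ?thesis using h3a[of a b q] that by blast
    qed
  qed
  \<comment> \<open>Writing a high end first leaves nine of the sixteen cases; \<open>disj'\<close>
    removes this convention by symmetry.\<close>
  have disj: "col (g a) (g b) \<noteq> col (g p) (g q)"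
    if h: "adj a b" "adj p q" "distinct [a, b, p, q]" "b \<in> high \<longrightarrow> a \<in> high" "q \<in> high \<longrightarrow> p \<in> high" for a b p q
  proof -
    have V: "a \<in> V" "b \<in> V" "p \<in> V" "q \<in> V" using that adj_V adj_V2 by auto
    have d: "a \<noteq> b" "p \<noteq> q" "{a, b} \<noteq> {p, q}" "b \<noteq> q" "distinct [b, p, q]" "distinct [q, a, b]"
      using that(3) by (auto simp: doubleton_eq_iff)
    consider "a \<in> high" "b \<in> high" "p \<in> high" "q \<in> high" | "a \<in> high" "b \<in> high" "p \<in> high" "q \<in> A"
      | "a \<in> high" "b \<in> high" "p \<in> A" "q \<in> A" | "a \<in> high" "b \<in> A" "p \<in> high" "q \<in> high"
      | "a \<in> high" "b \<in> A" "p \<in> high" "q \<in> A" | "a \<in> high" "b \<in> A" "p \<in> A" "q \<in> A"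
      | "a \<in> A" "b \<in> A" "p \<in> high" "q \<in> high" | "a \<in> A" "b \<in> A" "p \<in> high" "q \<in> A"
      | "a \<in> A" "b \<in> A" "p \<in> A" "q \<in> A" using V h(4,5) by blast
    then show ?thesis
    proof cases
      case 1
      then show ?thesis using hh[of a b p q] d by blast
    next
      case 2
      then show ?thesis using cU[of a b] bad1[of q p] d that by metis
    next
      case 3
      then show ?thesis using cU[of a b] h2a[of p q] d that by metis
    next
      case 4
      then show ?thesis using cU[of p q] bad1[of b a] d that by metis
    next
      case 5
      then show ?thesis using h2b[of b q a p] d that by blast
    next
      case 6
      then show ?thesis using h3b[of b p q a] d that by blast
    next
      case 7
      then show ?thesis using cU[of p q] h2a[of a b] d that by metis
    next
      case 8
      then show ?thesis using h3b[of q a b p] d that by metis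
    next
      case 9
      then show ?thesis using h4[of a b p q] that by blast
    qed
  qed
  have disj': "col (g a) (g b) \<noteq> col (g p) (g q)" if "adj a b" "adj p q" "distinct [a, b, p, q]" for a b p q
  proof -
    have s: "adj b a" "adj q p" using that adj_sym by auto
    have d: "distinct [b, a, p, q]" "distinct [a, b, q, p]" "distinct [b, a, q, p]" using that(3) by auto
    show ?thesis
      using disj[OF that] disj[OF s(1) that(2) d(1)] disj[OF that(1) s(2) d(2)] disj[OF s d(3)]
      by (metis col_sym)
  qed
  have "col (g a) (g b) \<noteq> col (g p) (g q)" if h: "adj a b" "adj p q" "{a, b} \<noteq> {p, q}" for a b p q
  proof -
    have s: "adj b a" "adj q p" using h adj_sym by auto
    have d: "a \<noteq> b" "p \<noteq> q" using h adj_irrefl by auto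
    consider "distinct [a, b, p, q]" | "a = p" "b \<noteq> q" | "a = q" "b \<noteq> p" | "b = p" "a \<noteq> q" | "b = q" "a \<noteq> p"
      using d h(3) by auto
    then show ?thesis
    proof cases
      case 1
      then show ?thesis using disj' h by blast
    next
      case 2
      then show ?thesis using cherry[of a b q] h by blast
    next
      case 3
      then show ?thesis using cherry[of a b p] h s by (metis col_sym)
    next
      case 4
      then show ?thesis using cherry[of b a q] h s by (metis col_sym)
    next
      case 5
      then show ?thesis using cherry[of b a p] h s by (metis col_sym)
    qed
  qed
  then show ?thesis using bij by blast
qed

end

text \<open>As there are at most \<open>R\<close> high vertices, a spread set of the same size
  exists, and any bijection onto it can be taken as \<open>\<phi>\<close>.\<close>

lemma rainbow_bijection:
  assumes "few_cherries V adj n R" "bounded_coloring n col k R"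
  shows "\<exists>g. bij_betw g V {..<n} \<and>
     (\<forall>a b p q. adj a b \<and> adj p q \<and> {a, b} \<noteq> {p, q} \<longrightarrow> col (g a) (g b) \<noteq> col (g p) (g q))"
proof -
  interpret few_cherries V adj n R by fact
  interpret bounded_coloring n col k R by fact
  have "real (card high) \<le> R" using at_most_high unfolding at_most_def by simp
  then obtain U where U: "spread U" "card U = card high" using exists_spread by blast
  then have "finite U" unfolding spread_def by (meson finite_lessThan finite_subset)
  then obtain \<phi> where \<phi>: "bij_betw \<phi> high U" using finite_same_card_bij[OF finite_high] U by metis
  interpret partial_embedding V adj n R col k \<phi>
    by unfold_locales (use \<phi> U in \<open>auto simp: bij_betw_def\<close>)
  show ?thesis by (rule rainbow_extension)
qed

section \<open>Translation from graphs and edge-colorings\<close>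

lemma at_most_cherry_paths:
  assumes G: "simple_graph G"
  shows "at_most {(y, z, w). {y, z} \<in> edges G \<and> {z, w} \<in> edges G \<and> y \<noteq> w} (2 * real (card (cherries G)))"
proof -
  have finG: "finite (verts G)" "finite (edges G)"
    using G finite_subset[of "edges G" "Pow (verts G)"] unfolding simple_graph_def by auto
  have "cherries G \<subseteq> Pow (verts G) \<times> Pow (edges G)"
    unfolding cherries_def subgraph_def by force
  then have fin: "finite (cherries G)" using finG finite_subset by blast
  let ?F = "\<lambda>H. {(y, z, w). distinct [y, z, w] \<and> H = ({y, z, w}, {{y, z}, {z, w}})}"
  \<comment> \<open>A cherry determines its center, so it comes from a path in the two directions
    only.\<close>
  have fibre: "at_most (?F H) 2" if H: "H \<in> cherries G" for H
  proof -
    obtain y z w where yzw: "distinct [y, z, w]" "H = ({y, z, w}, {{y, z}, {z, w}})"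
      using H unfolding cherries_def is_cherry_def by blast
    show ?thesis
      by (rule at_most_mono[OF at_most_doubleton[of "(y, z, w)" "(w, z, y)"]])
        (use yzw in \<open>auto simp: doubleton_eq_iff\<close>)
  qed
  have "at_most (\<Union>H\<in>cherries G. ?F H) (real (card (cherries G)) * 2)"
    by (rule at_most_UN[OF _ fibre]) (use fin in \<open>auto simp: at_most_def\<close>)
  moreover have "{(y, z, w). {y, z} \<in> edges G \<and> {z, w} \<in> edges G \<and> y \<noteq> w} \<subseteq> (\<Union>H\<in>cherries G. ?F H)"
  proof clarify
    fix y z w assume h: "{y, z} \<in> edges G" "{z, w} \<in> edges G" "y \<noteq> w"
    have E: "e \<subseteq> verts G \<and> card e = 2" if "e \<in> edges G" for e using G that unfolding simple_graph_def by auto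
    have d: "distinct [y, z, w]" using E[OF h(1)] E[OF h(2)] h(3) by (auto simp: card_insert_if split: if_splits)
    let ?H = "({y, z, w}, {{y, z}, {z, w}})"
    have "subgraph ?H G" unfolding subgraph_def simple_graph_def using h E[OF h(1)] E[OF h(2)] by auto
    then have "?H \<in> cherries G" unfolding cherries_def is_cherry_def using d by blast
    then show "(y, z, w) \<in> (\<Union>H\<in>cherries G. ?F H)" using d by (intro UN_I[of ?H]) auto
  qed
  ultimately show ?thesis by (rule at_most_mono) simp
qed

text \<open>An edge gives two arcs, hence the factor 2. With one end fixed, an edge is determined by
  the other end, so a star has the bound \<open>k\<close> itself.\<close>

lemma bounded_class_arcs:
  assumes "globally_bounded n k c"
  shows "at_most {(u, v). u < n \<and> v < n \<and> u \<noteq> v \<and> c {u, v} = a} (2 * k)"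
    and "u < n \<Longrightarrow> at_most {v. v < n \<and> u \<noteq> v \<and> c {u, v} = a} k"
proof -
  let ?C = "{e \<in> edges (complete_graph n). c e = a}"
  have "finite ?C" by (rule finite_subset[of _ "Pow {..<n}"]) (auto simp: complete_graph_def)
  then have C: "at_most ?C k" using assms unfolding globally_bounded_def at_most_def by simp
  have edge: "{u, v} \<in> ?C" if "u < n" "v < n" "u \<noteq> v" "c {u, v} = a" for u v
    using that unfolding complete_graph_def by auto
  have fibre: "at_most {(u, v). {u, v} = e} 2" if eC: "e \<in> ?C" for e :: "nat set"
  proof -
    obtain x y where e: "e = {x, y}" using eC unfolding complete_graph_def by (auto simp: card_2_iff)
    show ?thesis unfolding e
      by (rule at_most_mono[OF at_most_doubleton[of "(x, y)" "(y, x)"]]) (auto simp: doubleton_eq_iff)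
  qed
  have "at_most (\<Union>e\<in>?C. {(u, v). {u, v} = e}) (k * 2)" by (rule at_most_UN[OF C fibre]) auto
  then show "at_most {(u, v). u < n \<and> v < n \<and> u \<noteq> v \<and> c {u, v} = a} (2 * k)"
    by (rule at_most_mono) (use edge in auto)
  show "at_most {v. v < n \<and> u \<noteq> v \<and> c {u, v} = a} k" if "u < n"
  proof (rule at_most_inj_image)
    show "at_most ((\<lambda>v. {u, v}) ` {v. v < n \<and> u \<noteq> v \<and> c {u, v} = a}) k"
      by (rule at_most_mono[OF C]) (use that edge in auto)
  qed (auto simp: inj_on_def doubleton_eq_iff)
qed

lemma rainbow_if_bijection:
  assumes G: "simple_graph G" and g: "bij_betw g (verts G) {..<n}"
    and inj: "\<And>a b p q. {a, b} \<in> edges G \<Longrightarrow> {p, q} \<in> edges G \<Longrightarrow> {a, b} \<noteq> {p, q} \<Longrightarrow>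
      c {g a, g b} \<noteq> c {g p, g q}"
  shows "rainbow n G c"
proof -
  define H where "H = ({..<n}, (`) g ` edges G)"
  have E: "e \<subseteq> verts G" "card e = 2" if "e \<in> edges G" for e using G that unfolding simple_graph_def by auto
  have gi: "inj_on g (verts G)" using g by (simp add: bij_betw_def)
  have gE: "g ` e \<subseteq> {..<n}" "card (g ` e) = 2" if "e \<in> edges G" for e
  proof -
    show "g ` e \<subseteq> {..<n}" using E(1)[OF that] g unfolding bij_betw_def by blast
    show "card (g ` e) = 2" using card_image[OF inj_on_subset[OF gi E(1)[OF that]]] E(2)[OF that] by simp
  qed
  have sub: "subgraph H (complete_graph n)"
    unfolding subgraph_def simple_graph_def complete_graph_def H_def using gE by auto
  have iso: "graph_iso G H" unfolding graph_iso_def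
  proof (intro exI[of _ g] conjI ballI)
    show "bij_betw g (verts G) (verts H)" using g unfolding H_def by simp
    fix u v assume uv: "u \<in> verts G" "v \<in> verts G"
    have "{u, v} \<in> edges G" if "{g u, g v} = g ` e" "e \<in> edges G" for e
    proof -
      have "g ` {u, v} = g ` e" using that by simp
      then have "{u, v} = e" using inj_on_image_eq_iff[OF gi, of "{u, v}" e] uv E(1)[OF that(2)] by simp
      then show ?thesis using that by simp
    qed
    moreover have "g ` {u, v} = {g u, g v}" by simp
    ultimately show "{u, v} \<in> edges G \<longleftrightarrow> {g u, g v} \<in> edges H" unfolding H_def by (auto simp: image_iff) blast
  qed
  have "inj_on c (edges H)"
  proof (rule inj_onI)
    fix e f assume ef: "e \<in> edges H" "f \<in> edges H" "c e = c f"
    obtain e' f' where e': "e' \<in> edges G" "e = g ` e'" and f': "f' \<in> edges G" "f = g ` f'"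
      using ef unfolding H_def by auto
    obtain a b p q where ab: "e' = {a, b}" and pq: "f' = {p, q}" using E(2)[OF e'(1)] E(2)[OF f'(1)]
      unfolding card_2_iff by blast
    have "e' = f'"
    proof (rule ccontr)
      assume "e' \<noteq> f'"
      then have "c {g a, g b} \<noteq> c {g p, g q}" using inj[of a b p q] e'(1) f'(1) ab pq by simp
      then show False using ef(3) e'(2) f'(2) ab pq by simp
    qed
    then show "e = f" using e' f' by simp
  qed
  then show ?thesis unfolding rainbow_def using sub iso by blast
qed

theorem theorem1p7:
  fixes n r :: nat and G :: "'a graph" and c :: "nat set \<Rightarrow> 'c"
  assumes "n > 0"
    and "r > 0"
    and "simple_graph G"
    and "card (verts G) = n"
    and "card (cherries G) \<le> r"
    and "globally_bounded n (real n / (1512 * real r powr (3 / 4))) c"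
  shows "rainbow n G c"
proof (cases "n = 1")
  \<comment> \<open>A graph on one vertex has no edges. The case is separate because
    \<open>1 \<le> k\<close> is derived below from the existence of an edge.\<close>
  case True
  have fin: "finite (verts G)" using assms(3) unfolding simple_graph_def by simp
  obtain g where g: "bij_betw g (verts G) {..<n}"
    using finite_same_card_bij[OF fin finite_lessThan[of n]] assms(4) by auto
  have "edges G = {}"
  proof -
    have "card e \<le> 1" if "e \<in> edges G" for e
      using card_mono[OF fin, of e] assms(3,4) True that unfolding simple_graph_def by auto
    then show ?thesis using assms(3) unfolding simple_graph_def by fastforce
  qed
  then show ?thesis using rainbow_if_bijection[OF assms(3) g] by auto
next
  case False
  define R where "R = real r powr (1 / 4)"
  define k where "k = real n / (1512 * real r powr (3 / 4))"
  have R1: "1 \<le> R" using assms(2) unfolding R_def by (simp add: ge_one_powr_ge_zero)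
  have R3: "R ^ 3 = real r powr (3 / 4)" and R4: "R ^ 4 = real r"
    using assms(2) unfolding R_def by (auto simp: powr_powr powr_numeral simp flip: powr_realpow)
  have gb: "globally_bounded n k c" using assms(6) unfolding k_def .
  have kn: "1512 * (k * R ^ 3) = real n" unfolding k_def R3 using assms(2) by simp
  \<comment> \<open>The color class of the edge \<open>{0, 1}\<close> is nonempty and has at most
    \<open>k\<close> edges.\<close>
  have k1: "1 \<le> k"
  proof -
    have "1 < n" using assms(1) False by simp
    then have one: "1 \<in> {v. v < n \<and> 0 \<noteq> v \<and> c {0, v} = c {0, 1}}" by simp
    have am: "at_most {v. v < n \<and> 0 \<noteq> v \<and> c {0, v} = c {0, 1}} k"
      using bounded_class_arcs(2)[OF gb] assms(1) .
    have "card {v. v < n \<and> 0 \<noteq> v \<and> c {0, v} = c {0, 1}} \<noteq> 0"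
      using one am unfolding at_most_def using card_0_eq by blast
    then show ?thesis using am unfolding at_most_def by linarith
  qed
  have bc: "bounded_coloring n (\<lambda>u v. c {u, v}) k R"
    by unfold_locales (use k1 R1 kn bounded_class_arcs[OF gb] in \<open>auto simp: insert_commute\<close>)
  have fc: "few_cherries (verts G) (\<lambda>u v. {u, v} \<in> edges G) n R"
  proof
    have E: "e \<subseteq> verts G \<and> card e = 2" if "e \<in> edges G" for e
      using assms(3) that unfolding simple_graph_def by auto
    show "{v, v} \<notin> edges G" for v using E[of "{v, v}"] by auto
    show "u \<in> verts G" if "{u, v} \<in> edges G" for u v using E[OF that] by auto
    show "at_most {(y, z, w). {y, z} \<in> edges G \<and> {z, w} \<in> edges G \<and> y \<noteq> w} (2 * R ^ 4)"
      by (rule at_most_mono[OF at_most_cherry_paths[OF assms(3)]]) (use assms(5) R4 in auto)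
    have "1 * R ^ 3 \<le> k * R ^ 3" using k1 R1 by (intro mult_right_mono) auto
    then show "1512 * R ^ 3 \<le> real n" using kn by linarith
  qed (use assms R1 in \<open>auto simp: simple_graph_def insert_commute\<close>)
  obtain g where "bij_betw g (verts G) {..<n}"
    "\<And>a b p q. {a, b} \<in> edges G \<Longrightarrow> {p, q} \<in> edges G \<Longrightarrow> {a, b} \<noteq> {p, q} \<Longrightarrow>
      c {g a, g b} \<noteq> c {g p, g q}"
    using rainbow_bijection[OF fc bc] by blast
  then show ?thesis by (rule rainbow_if_bijection[OF assms(3)])
qed

end
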